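(* Let $z^\star\in\mathbb{T}^n$ be fixed and let $C=(z^\star)(z^\star)^H+\Delta$, where $\Delta=\sigma W$ with $\sigma\in\left(0,\frac{\sqrt n}{48}\right]$ and $W\in\mathbb{C}^{n\times n}$ a Wigner matrix. Suppose further that the step size $\alpha$ satisfies $\alpha\ge2$ and that the initial point is $z^0=v_C$ (the eigenvector estimator of $C$). Then, with probability at least $1-2n^{-5/4}-2e^{-n/2}$, the sequence of iterates $\{z^k\}_{k\ge0}$ generated by the generalized power method with objective matrix $C$, step size $\alpha$ and initial point $z^0$ satisfies $$ d_2(z^{k+1},z^\star)\le\left(\frac{\alpha+16}{7\alpha+8}\right)^{k+1}d_2(z^0,z^\star)+\frac{24\alpha}{3\alpha-4}\,\sigma, $$ $$ d_\infty(z^{k+1},z^\star)\le\left(\frac{16}{7\alpha+8}\right)^{k+1}d_\infty(z^0,z^\star)+\left(\frac{\alpha+16}{7\alpha+8}\right)^{k+1}\frac{\sqrt n}{2}+\frac{48\alpha}{7\alpha+8}\left(\sqrt{\log n}+\frac{24\alpha}{3\alpha-4}\,\sigma\right)\frac{\sigma}{\sqrt n} $$ for $k=0,1,\ldots$.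
   Context: $\mathbb{T}^n=\{w\in\mathbb{C}^n: |w_1|=\cdots=|w_n|=1\}$; $(\cdot)^H$ is the Hermitian transpose. A Wigner matrix here is a Hermitian random matrix whose diagonal entries are zero and whose above-diagonal entries are i.i.d. standard complex normal random variables. For $v\in\mathbb{C}^n$, $\frac{v}{|v|}\in\mathbb{C}^n$ is the vector with $j$-th entry $v_j/|v_j|$ if $v_j\ne 0$ and $0$ otherwise. Distance: for $q\in[1,\infty]$, $d_q(w,z)=\min_{\theta\in[0,2\pi)}\|w-e^{i\theta}z\|_q$ (the same formula is used should an iterate have a zero entry). Generalized power method: given a Hermitian matrix $C\in\mathbb{C}^{n\times n}$, a step size $\alpha>0$ and an initial point $z^0\in\mathbb{T}^n$, the iterates are defined for $k=0,1,\ldots$ by $w^k=\left(I+\frac{\alpha}{n}C\right)z^k$, $z^{k+1}=\frac{w^k}{|w^k|}$ (run without termination). Eigenvector estimator: let $u\in\mathbb{C}^n$ be a leading eigenvector of $C$ (an eigenvector for the largest eigenvalue) and let $a\in\mathbb{C}^n$ be any vector with $a^Hu\ne 0$. Then $v_C\in\mathbb{T}^n$ is defined by $(v_C)_j=\frac{u_j}{|u_j|}$ if $u_j\ne0$ and $(v_C)_j=\frac{a^Hu}{|a^Hu|}$ otherwise, $j=1,\dots,n$. *)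

theory Defs
  imports "HOL-Probability.Probability"
begin

definition torus :: "(complex ^ 'n) set" where
  "torus = {w. \<forall>j. cmod (w $ j) = 1}"

definition herm_inner :: "complex ^ 'n \<Rightarrow> complex ^ 'n \<Rightarrow> complex" where
  "herm_inner a u = (\<Sum>j\<in>UNIV. cnj (a $ j) * u $ j)"

definition herm_outer :: "complex ^ 'n \<Rightarrow> complex ^ 'n \<Rightarrow> complex ^ 'n ^ 'n" where
  "herm_outer x y = (\<chi> i j. x $ i * cnj (y $ j))"

definition phase_vec :: "complex ^ 'n \<Rightarrow> complex ^ 'n" where
  "phase_vec v = (\<chi> j. if v $ j \<noteq> 0 then v $ j / of_real (cmod (v $ j)) else 0)"

text \<open>
  The library's \<open>infnorm\<close> is not the maximum norm on complex vectors: it takes the maximum of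
  the real and imaginary parts of the entries instead of their moduli. Hence the norms are
  defined here from the moduli, for all exponents in the extended interval from 1 to infinity.
\<close>

definition lq_norm :: "ereal \<Rightarrow> complex ^ 'n \<Rightarrow> real" where
  "lq_norm q x =
     (if q = \<infinity> then Max (range (\<lambda>j. cmod (x $ j)))
      else (\<Sum>j\<in>UNIV. cmod (x $ j) powr real_of_ereal q) powr (1 / real_of_ereal q))"

lemma lq_norm_2: "lq_norm 2 x = norm x"
proof -
  have "(\<Sum>j\<in>UNIV. cmod (x $ j) powr 2) = (\<Sum>j\<in>UNIV. (cmod (x $ j))\<^sup>2)"
    by (intro sum.cong) (auto simp: powr_numeral)
  then show ?thesis
    by (simp add: lq_norm_def norm_vec_def L2_set_def powr_half_sqrt sum_nonneg)
qed

text \<open>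
  The infimum below is attained (lemma \<open>phase_dist_attained\<close>), so it is the minimum.
\<close>

definition phase_dist :: "ereal \<Rightarrow> complex ^ 'n \<Rightarrow> complex ^ 'n \<Rightarrow> real" where
  "phase_dist q w z = (INF \<theta>\<in>{0..<2 * pi}. lq_norm q (w - cis \<theta> *s z))"

lemma continuous_on_Max_finite:
  fixes f :: "'i \<Rightarrow> 'a::topological_space \<Rightarrow> real"
  assumes "finite I" "I \<noteq> {}" "\<And>i. i \<in> I \<Longrightarrow> continuous_on S (f i)"
  shows "continuous_on S (\<lambda>x. Max ((\<lambda>i. f i x) ` I))"
  using assms
proof (induction I rule: finite_ne_induct)
  case (singleton i)
  then show ?case by simp
next
  case (insert i I)
  then have "continuous_on S (\<lambda>x. max (f i x) (Max ((\<lambda>i. f i x) ` I)))"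
    by (intro continuous_on_max) auto
  with insert.hyps show ?case by (simp add: Max_insert)
qed

lemma phase_dist_attained:
  fixes w z :: "complex ^ 'n"
  assumes "1 \<le> q"
  shows "\<exists>\<theta>\<in>{0..<2 * pi}. phase_dist q w z = lq_norm q (w - cis \<theta> *s z) \<and>
           (\<forall>\<phi>. lq_norm q (w - cis \<theta> *s z) \<le> lq_norm q (w - cis \<phi> *s z))"
proof -
  define g where "g = (\<lambda>\<theta>. lq_norm q (w - cis \<theta> *s z))"
  have entry: "continuous_on UNIV (\<lambda>\<theta>. cmod ((w - cis \<theta> *s z) $ j))" for j
    by (auto intro!: continuous_intros simp: cis.ctr Complex_eq)
  have cont: "continuous_on UNIV g"
  proof (cases "q = \<infinity>")
    case True
    then have "g = (\<lambda>\<theta>. Max ((\<lambda>j. cmod ((w - cis \<theta> *s z) $ j)) ` UNIV))"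
      by (simp add: g_def lq_norm_def)
    then show ?thesis
      using continuous_on_Max_finite[OF finite UNIV_not_empty entry] by simp
  next
    case False
    with assms have pos: "real_of_ereal q > 0"
      by (cases q) auto
    have "continuous_on UNIV (\<lambda>\<theta>. (\<Sum>j\<in>UNIV. cmod ((w - cis \<theta> *s z) $ j) powr real_of_ereal q)
            powr (1 / real_of_ereal q))"
      using pos
      by (intro continuous_on_powr' continuous_on_sum continuous_on_const entry)
        (auto intro!: sum_nonneg)
    with False show ?thesis by (simp add: g_def lq_norm_def)
  qed
  obtain t where t: "t \<in> {0..2 * pi}" "\<And>\<phi>. \<phi> \<in> {0..2 * pi} \<Longrightarrow> g t \<le> g \<phi>"
    using continuous_attains_inf[of "{0..2 * pi}" g] continuous_on_subset[OF cont] by auto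
  define \<theta> where "\<theta> = (if t = 2 * pi then 0 else t)"
  have \<theta>: "\<theta> \<in> {0..<2 * pi}" "g \<theta> = g t"
    using t(1) by (auto simp: \<theta>_def g_def)
  have all: "g \<theta> \<le> g \<phi>" for \<phi>
  proof -
    obtain \<psi> where "\<psi> \<in> {0..<2 * pi}" "cis \<psi> = cis \<phi>"
    proof -
      define \<psi> where "\<psi> = Arg2pi (cis \<phi>)"
      have "\<psi> \<in> {0..<2 * pi}" using Arg2pi[of "cis \<phi>"] by (simp add: \<psi>_def)
      moreover have "cis \<psi> = cis \<phi>"
        using Arg2pi_eq[of "cis \<phi>"] by (simp add: \<psi>_def cis_conv_exp)
      ultimately show thesis using that by blast
    qed
    then show ?thesis using t(2)[of \<psi>] \<theta>(2) by (simp add: g_def)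
  qed
  have "(INF \<theta>\<in>{0..<2 * pi}. g \<theta>) = g \<theta>"
    using \<theta>(1) all by (intro cInf_eq_minimum) auto
  then show ?thesis
    using \<theta>(1) all by (auto simp: phase_dist_def g_def)
qed

definition eigenpair :: "complex ^ 'n ^ 'n \<Rightarrow> complex \<Rightarrow> complex ^ 'n \<Rightarrow> bool" where
  "eigenpair C \<mu> u \<longleftrightarrow> u \<noteq> 0 \<and> C *v u = \<mu> *s u"

text \<open>
  Used for Hermitian matrices only, whose eigenvalues are all real.
\<close>

definition leading_eigenvector :: "complex ^ 'n ^ 'n \<Rightarrow> complex ^ 'n \<Rightarrow> bool" where
  "leading_eigenvector C u \<longleftrightarrow>
     (\<exists>\<mu>::real. eigenpair C (of_real \<mu>) u \<and>
        (\<forall>(\<nu>::real) v. eigenpair C (of_real \<nu>) v \<longrightarrow> \<nu> \<le> \<mu>))"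

definition eigenvector_phases :: "complex ^ 'n \<Rightarrow> complex ^ 'n \<Rightarrow> complex ^ 'n" where
  "eigenvector_phases a u =
     (\<chi> j. if u $ j \<noteq> 0 then u $ j / of_real (cmod (u $ j))
          else herm_inner a u / of_real (cmod (herm_inner a u)))"

text \<open>
  The estimator depends on the choice of a leading eigenvector and of an auxiliary vector, so it
  is a relation between the matrix and the estimate.
\<close>

definition eigenvector_estimator :: "complex ^ 'n ^ 'n \<Rightarrow> complex ^ 'n \<Rightarrow> bool" where
  "eigenvector_estimator C v \<longleftrightarrow>
     (\<exists>u a. leading_eigenvector C u \<and> herm_inner a u \<noteq> 0 \<and> v = eigenvector_phases a u)"

primrec gpm :: "complex ^ 'n ^ 'n \<Rightarrow> real \<Rightarrow> complex ^ 'n \<Rightarrow> nat \<Rightarrow> complex ^ 'n" where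
  "gpm C \<alpha> z0 0 = z0"
| "gpm C \<alpha> z0 (Suc k) =
     phase_vec ((mat 1 + (\<alpha> / real CARD('n)) *\<^sub>R C) *v gpm C \<alpha> z0 k)"

text \<open>
  A standard complex normal variable has total variance 1: its real and imaginary parts are
  independent with variance 1/2 each. The last argument of \<open>normal_density\<close> before the point is
  the standard deviation.
\<close>

definition (in prob_space) std_complex_normal :: "('a \<Rightarrow> complex) \<Rightarrow> bool" where
  "std_complex_normal X \<longleftrightarrow>
     distributed M lborel (\<lambda>\<omega>. Re (X \<omega>)) (normal_density 0 (1 / sqrt 2)) \<and>
     distributed M lborel (\<lambda>\<omega>. Im (X \<omega>)) (normal_density 0 (1 / sqrt 2)) \<and>
     indep_var borel (\<lambda>\<omega>. Re (X \<omega>)) borel (\<lambda>\<omega>. Im (X \<omega>))"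

text \<open>
  The linear order on the index type serves only to say which entries lie above the diagonal.
\<close>

definition (in prob_space) wigner_matrix ::
    "('a \<Rightarrow> complex ^ 'n::{finite,linorder} ^ 'n::{finite,linorder}) \<Rightarrow> bool" where
  "wigner_matrix W \<longleftrightarrow>
     (\<forall>\<omega>\<in>space M. \<forall>i j. W \<omega> $ j $ i = cnj (W \<omega> $ i $ j)) \<and>
     (\<forall>\<omega>\<in>space M. \<forall>i. W \<omega> $ i $ i = 0) \<and>
     indep_vars (\<lambda>_. borel) (\<lambda>(i, j) \<omega>. W \<omega> $ i $ j) {(i, j). i < j} \<and>
     (\<forall>i j. i < j \<longrightarrow> std_complex_normal (\<lambda>\<omega>. W \<omega> $ i $ j))"

end

theory Submission
  imports Defs
begin

text \<open>
  The theorem follows from two bounds on the noise, \<open>\<parallel>W\<parallel> \<le> 3 \<surd>n\<close> and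
  \<open>\<parallel>W z\<parallel>\<^sub>\<infinity> \<le> 3 \<surd>(n ln n)\<close> for the ground truth \<open>z\<close>.

  In the 2-norm, normalising an entry at most doubles its relative error, and this gives the stated
  contraction factor. In the maximum norm the geometrically decaying terms are not needed: the
  estimator is entrywise within the limiting error \<open>T\<close> already, because \<open>\<mu> u = (z\<^sup>H u) z + \<Delta> u\<close> for
  a leading eigenvector \<open>u\<close>, and the power method preserves this. If \<open>T \<ge> 2\<close> there is nothing
  to prove. If \<open>T < 2\<close>, the relative errors of all entries before normalisation stay below 4/5,
  where normalising costs only a factor \<open>\<surd>5 / 2\<close>.

  The operator norm is bounded by a change of measure in place of a net. The exponential moments of
  the quadratic form at the points of an integer grid, averaged over a discrete Gaussian prior, have
  mean at most 1. On the other hand, if the form is at least \<open>3 \<surd>n\<close> at a unit vector, then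
  rounding a multiple of this vector at random and applying Jensen's inequality bounds the average
  from below by \<open>exp (n / 2)\<close>.
\<close>

section \<open>Normalisation of complex numbers\<close>

text \<open>The obstacle is dependence: the leading eigenvector and all iterates are functions of
  the noise, so no entrywise concentration bound applies to their images under \<open>W\<close>.
  Each such vector is split into a phase multiple of the fixed ground truth, for which Gaussian
  tails suffice, and a remainder, for which the operator norm times the distance in the 2-norm is
  enough. With a remainder of order \<sigma>, this crude second bound costs a multiple of \<sigma>^2
  / sqrt n after division by n, which the limiting error in the maximum norm already contains.

  The conditions \<alpha> \<ge> 2 and \<sigma> \<le> sqrt n / 48 meet in the 2-norm: they put the
  limiting error below sqrt n / 2, the radius inside which one step is known to contract.

  The bound on the operator norm is of PAC-Bayes type. A vector at which the form is large is
  replaced by a law concentrated near it, and the price is the relative entropy of that law with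
  respect to the prior. This price is linear in n, like the gain in the exponent, so uniformity over
  the sphere needs no union bound.\<close>

lemma cmod_sgn_diff_sqr:
  fixes v w :: complex
  assumes "cmod v = 1" "w \<noteq> 0"
  shows "(cmod (sgn w - v))\<^sup>2 = 2 - 2 * (v \<bullet> sgn w)"
proof -
  have "v \<bullet> v = 1" "sgn w \<bullet> sgn w = 1"
    using assms by (simp_all add: norm_sgn flip: norm_eq_1)
  then show ?thesis
    by (simp add: power2_norm_eq_inner inner_diff inner_commute)
qed

text \<open>The triangle inequality through \<open>of_real r * sgn w\<close> gives the factor 2,
  since \<open>\<bar>r - cmod w\<bar>\<close> is itself at most
  \<open>cmod (w - of_real r * v)\<close>. Writing the left side with an inner product in place of a
  squared distance admits \<open>w = 0\<close>, where it equals 2 and the right side 4.\<close>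

lemma sgn_potential_le:
  fixes v w :: complex
  assumes v: "cmod v = 1" and r: "r > 0"
  shows "2 - 2 * (v \<bullet> sgn w) \<le> (2 * cmod (w - of_real r * v) / r)\<^sup>2"
proof (cases "w = 0")
  case True
  then show ?thesis using assms by (simp add: norm_mult)
next
  case False
  have e1: "w = of_real (cmod w) * sgn w"
    using False by (simp add: sgn_div_norm scaleR_conv_of_real)
  have "r * cmod (sgn w - v) = cmod (of_real r * sgn w - of_real r * v)"
    using r by (simp add: norm_mult flip: right_diff_distrib)
  also have "\<dots> \<le> cmod (of_real r * sgn w - w) + cmod (w - of_real r * v)"
    using norm_triangle_ineq[of "of_real r * sgn w - w" "w - of_real r * v"] by simp
  also have "cmod (of_real r * sgn w - w) = cmod ((of_real r - of_real (cmod w)) * sgn w)"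
    using e1 by (metis left_diff_distrib)
  also have "\<dots> = \<bar>r - cmod w\<bar>"
    using False by (simp add: norm_mult norm_sgn flip: of_real_diff)
  also have "\<dots> \<le> cmod (w - of_real r * v)"
    using norm_triangle_ineq3[of w "of_real r * v"] r v by (simp add: norm_mult)
  finally have "cmod (sgn w - v) \<le> 2 * cmod (w - of_real r * v) / r"
    using r by (simp add: field_simps)
  then have "(cmod (sgn w - v))\<^sup>2 \<le> (2 * cmod (w - of_real r * v) / r)\<^sup>2"
    by (intro power_mono) auto
  then show ?thesis using cmod_sgn_diff_sqr[OF v False] by simp
qed

text \<open>Let c be the cosine of the angle between u and w, and x the squared relative error. The
  distance from u to the line through w gives 1 - c^2 \<le> x \<le> (4/5)^2, hence c \<ge> 3/5, and
  then 2 - 2c = 2 (1 - c^2) / (1 + c) is at most 2x / (8/5).\<close>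

lemma sgn_diff_le:
  fixes u w :: complex
  assumes u: "u \<noteq> 0" and close: "cmod (w - u) \<le> 4 / 5 * cmod u"
  shows "w \<noteq> 0" and "(cmod (sgn w - sgn u))\<^sup>2 \<le> 5 / 4 * (cmod (w - u) / cmod u)\<^sup>2"
proof -
  show w: "w \<noteq> 0"
    using assms by auto
  define c where "c = sgn u \<bullet> sgn w"
  define x where "x = (cmod (w - u) / cmod u)\<^sup>2"
  have nu: "cmod u > 0" and nw: "cmod w > 0" using u w by auto
  have uw: "u \<bullet> w = cmod u * cmod w * c"
    using nu nw by (simp add: c_def sgn_div_norm field_simps)
  have "(cmod (w - u))\<^sup>2 = (cmod w)\<^sup>2 - 2 * (cmod u * cmod w * c) + (cmod u)\<^sup>2"
    unfolding uw[symmetric] by (simp add: power2_norm_eq_inner inner_diff inner_commute)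
  also have "\<dots> = (cmod w - cmod u * c)\<^sup>2 + (cmod u)\<^sup>2 * (1 - c\<^sup>2)"
    by (simp add: power2_eq_square algebra_simps)
  finally have d: "(cmod (w - u))\<^sup>2 = (cmod w - cmod u * c)\<^sup>2 + (cmod u)\<^sup>2 * (1 - c\<^sup>2)" .
  have x: "x * (cmod u)\<^sup>2 = (cmod (w - u))\<^sup>2"
    using nu by (simp add: x_def power_divide)
  have "x \<le> (4 / 5)\<^sup>2"
    unfolding x_def using nu close by (intro power_mono) (auto simp: field_simps)
  then have x1: "x \<le> 16 / 25" by (simp add: power2_eq_square)
  \<comment> \<open>The bound on c^2 leaves the sign of c open. A right or obtuse angle would put w
    at distance at least \<open>cmod u\<close> from u.\<close>
  have c0: "c > 0"
  proof (rule ccontr)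
    assume "\<not> c > 0"
    then have "cmod u * cmod w * c \<le> 0"
      using nu nw by (simp add: mult_nonneg_nonpos)
    then have "(cmod u)\<^sup>2 \<le> (cmod (w - u))\<^sup>2"
      using \<open>(cmod (w - u))\<^sup>2 = (cmod w)\<^sup>2 - 2 * (cmod u * cmod w * c) + (cmod u)\<^sup>2\<close>
        zero_le_power2[of "cmod w"] by linarith
    then have "cmod u \<le> cmod (w - u)" by (rule power2_le_imp_le) simp
    with close nu show False by linarith
  qed
  have "(1 - c\<^sup>2) * (cmod u)\<^sup>2 \<le> x * (cmod u)\<^sup>2"
    unfolding x d by (simp add: algebra_simps)
  then have cx: "1 - c\<^sup>2 \<le> x" using nu by simp
  then have "(3 / 5)\<^sup>2 \<le> c\<^sup>2" using x1 by (simp add: power_divide)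
  then have c1: "3 / 5 \<le> c" by (rule power2_le_imp_le) (use c0 in simp)
  have cle: "c \<le> 1"
    using norm_cauchy_schwarz[of "sgn u" "sgn w"] u w by (simp add: c_def norm_sgn)
  have "(1 - c) * (8 / 5) \<le> (1 - c) * (1 + c)"
    using c1 cle by (intro mult_left_mono) auto
  moreover have "(1 - c) * (1 + c) = 1 - c\<^sup>2"
    by (simp add: power2_eq_square algebra_simps)
  ultimately have "2 - 2 * c \<le> 5 / 4 * x" using cx by simp
  then show "(cmod (sgn w - sgn u))\<^sup>2 \<le> 5 / 4 * (cmod (w - u) / cmod u)\<^sup>2"
    using cmod_sgn_diff_sqr[of "sgn u" w] u w by (simp add: x_def c_def norm_sgn)
qed

text \<open>The constant is a rational upper bound for sqrt 5 / 2, tight to within 1/10000.\<close>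

lemma sgn_diff_le':
  fixes u w :: complex
  assumes u: "u \<noteq> 0" and close: "cmod (w - u) \<le> 4 / 5 * cmod u"
  shows "cmod (sgn w - sgn u) \<le> 11181 / 10000 * (cmod (w - u) / cmod u)"
proof -
  have "(cmod (sgn w - sgn u))\<^sup>2 \<le> 5 / 4 * (cmod (w - u) / cmod u)\<^sup>2"
    by (rule sgn_diff_le[OF assms])
  also have "\<dots> \<le> (11181 / 10000)\<^sup>2 * (cmod (w - u) / cmod u)\<^sup>2"
    by (intro mult_right_mono) (auto simp: power2_eq_square)
  finally have "(cmod (sgn w - sgn u))\<^sup>2 \<le> (11181 / 10000 * (cmod (w - u) / cmod u))\<^sup>2"
    by (simp only: power_mult_distrib)
  then show ?thesis
    by (rule power2_le_imp_le) simp
qed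

section \<open>Phase distance\<close>

lemma norm_vec_sqr: "(norm (x :: complex ^ 'n))\<^sup>2 = (\<Sum>j\<in>UNIV. (cmod (x $ j))\<^sup>2)"
  by (simp add: norm_vec_def L2_set_def sum_nonneg)

lemma phase_dist_le:
  assumes "1 \<le> q" "cmod c = 1"
  shows "phase_dist q w z \<le> lq_norm q (w - c *s z)"
proof -
  have "c = cis (Arg c)" using assms(2) by (metis rcis_cmod_Arg rcis_def of_real_1 mult_1)
  then show ?thesis using phase_dist_attained[OF assms(1), of w z] by metis
qed

lemma phase_dist_2_le:
  assumes "cmod c = 1"
  shows "phase_dist 2 w z \<le> norm (w - c *s z)"
proof -
  have "(1::ereal) \<le> 2" by (simp add: one_ereal_def)
  from phase_dist_le[OF this assms] show ?thesis
    unfolding lq_norm_2 .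
qed

lemma phase_dist_infty_le:
  fixes w z :: "complex ^ 'n"
  assumes "cmod c = 1" "\<And>j. cmod (w $ j - c * z $ j) \<le> b"
  shows "phase_dist \<infinity> w z \<le> b"
proof -
  have "phase_dist \<infinity> w z \<le> lq_norm \<infinity> (w - c *s z)"
    using assms(1) by (intro phase_dist_le) auto
  also have "\<dots> \<le> b"
    using assms(2) by (auto simp: lq_norm_def)
  finally show ?thesis .
qed

lemma lq_norm_nonneg: "0 \<le> lq_norm q (x :: complex ^ 'n)"
  by (auto simp: lq_norm_def Max_ge_iff)

lemma phase_dist_nonneg: "0 \<le> phase_dist q w z"
  unfolding phase_dist_def by (intro cINF_greatest lq_norm_nonneg) auto

section \<open>Hermitian matrices\<close>

definition hermitian :: "complex ^ 'n ^ 'n \<Rightarrow> bool" where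
  "hermitian A \<longleftrightarrow> (\<forall>i j. A $ j $ i = cnj (A $ i $ j))"

lemma inner_vec_complex: "x \<bullet> y = Re (herm_inner x y)" for x y :: "complex ^ 'n"
  by (simp add: inner_vec_def herm_inner_def inner_complex_def)

lemma hermitian_inner:
  assumes "hermitian A"
  shows "herm_inner x (A *v y) = herm_inner (A *v x) y"
proof -
  have A: "cnj (A $ j $ i) = A $ i $ j" for i j
    using assms unfolding hermitian_def by metis
  have "herm_inner x (A *v y) = (\<Sum>i\<in>UNIV. \<Sum>j\<in>UNIV. cnj (x $ i) * (A $ i $ j * y $ j))"
    by (simp add: herm_inner_def matrix_vector_mult_def sum_distrib_left)
  also have "\<dots> = (\<Sum>j\<in>UNIV. \<Sum>i\<in>UNIV. cnj (x $ i) * (A $ i $ j * y $ j))"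
    by (rule sum.swap)
  also have "\<dots> = (\<Sum>j\<in>UNIV. \<Sum>i\<in>UNIV. cnj (A $ j $ i * x $ i) * y $ j)"
    by (intro sum.cong refl) (simp add: A mult_ac)
  also have "\<dots> = herm_inner (A *v x) y"
    by (simp add: herm_inner_def matrix_vector_mult_def sum_distrib_right)
  finally show ?thesis .
qed

lemma hermitian_dot:
  assumes "hermitian A"
  shows "x \<bullet> (A *v y) = (A *v x) \<bullet> (y :: complex ^ 'n)"
  using hermitian_inner[OF assms] by (simp add: inner_vec_complex)

lemma matrix_vector_scaleR: "A *v (c *\<^sub>R x) = c *\<^sub>R (A *v x)" for A :: "complex ^ 'n ^ 'm"
  by (simp add: vec_eq_iff matrix_vector_mult_def scaleR_sum_right)

lemma scaleR_matrix_vector: "(c *\<^sub>R A) *v x = c *\<^sub>R (A *v x)" for A :: "complex ^ 'n ^ 'm"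
  by (simp add: vec_eq_iff matrix_vector_mult_def scaleR_sum_right)

text \<open>Polarisation: if y is \<open>A *v x\<close> rescaled to the norm of x, then four times
  the inner product of y with \<open>A *v x\<close> is the form at x + y minus the form at x - y,
  and the parallelogram law adds up the two bounds. This turns a bound on the quadratic form into
  one on the operator norm.\<close>

lemma hermitian_norm_le:
  fixes A :: "complex ^ 'n ^ 'n"
  assumes A: "hermitian A" and q: "\<And>x. \<bar>x \<bullet> (A *v x)\<bar> \<le> c * (norm x)\<^sup>2"
  shows "norm (A *v x) \<le> c * norm x"
proof (cases "A *v x = 0 \<or> x = 0")
  case True
  then show ?thesis
  proof
    assume z: "A *v x = 0"
    have "0 \<le> c * (norm x)\<^sup>2" using q[of x] by linarith
    then have "0 \<le> c * norm x" by (simp add: zero_le_mult_iff)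
    then show ?thesis using z by simp
  qed simp
next
  case False
  define y where "y = (norm x / norm (A *v x)) *\<^sub>R (A *v x)"
  have ny: "norm y = norm x" using False by (simp add: y_def)
  have "4 * (y \<bullet> (A *v x)) = (x + y) \<bullet> (A *v (x + y)) - (x - y) \<bullet> (A *v (x - y))"
    using hermitian_dot[OF A, of x y]
    by (simp add: matrix_vector_right_distrib matrix_vector_mult_diff_distrib inner_diff inner_add inner_commute)
  also have "\<dots> \<le> c * (norm (x + y))\<^sup>2 + c * (norm (x - y))\<^sup>2"
    using q[of "x + y"] q[of "x - y"] by linarith
  also have "\<dots> = c * (2 * (norm x)\<^sup>2 + 2 * (norm y)\<^sup>2)"
    by (simp add: power2_norm_eq_inner inner_diff inner_add inner_commute algebra_simps)
  finally have "y \<bullet> (A *v x) \<le> c * (norm x)\<^sup>2" by (simp add: ny)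
  moreover have "y \<bullet> (A *v x) = norm x * norm (A *v x)"
    using False by (simp add: y_def dot_square_norm power2_eq_square)
  ultimately show ?thesis using False by (simp add: power2_eq_square mult.assoc)
qed

text \<open>A maximiser of the form on the compact unit sphere is an eigenvector, because a nonzero
  residual d would be a direction of ascent. The link is needed because
  \<open>leading_eigenvector\<close> compares with eigenvalues only, whereas the noise bound
  controls the Rayleigh quotient at the ground truth.\<close>

lemma hermitian_eigenvalue_ge:
  fixes A :: "complex ^ 'n ^ 'n"
  assumes A: "hermitian A" and x: "norm x = 1"
  shows "\<exists>\<nu> v. eigenpair A (of_real \<nu>) v \<and> x \<bullet> (A *v x) \<le> \<nu>"
proof -
  have cont: "continuous_on (sphere 0 1) (\<lambda>v. v \<bullet> (A *v v))"
    by (intro continuous_intros linear_continuous_on_compose linear_continuous_on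
        linear_conv_bounded_linear[THEN iffD1])
      (auto intro!: linearI simp: matrix_vector_right_distrib matrix_vector_scaleR)
  have "compact (sphere (0 :: complex ^ 'n) 1)" "sphere (0 :: complex ^ 'n) 1 \<noteq> {}"
    using x by auto
  from continuous_attains_sup[OF this cont] obtain v where v: "norm v = 1"
    and max: "\<And>y. norm y = 1 \<Longrightarrow> y \<bullet> (A *v y) \<le> v \<bullet> (A *v v)"
    by auto
  define \<nu> where "\<nu> = v \<bullet> (A *v v)"
  define d where "d = A *v v - \<nu> *\<^sub>R v"
  have all: "y \<bullet> (A *v y) \<le> \<nu> * (norm y)\<^sup>2" for y
  proof (cases "y = 0")
    case False
    have "(y /\<^sub>R norm y) \<bullet> (A *v (y /\<^sub>R norm y)) \<le> \<nu>"
      unfolding \<nu>_def using False by (intro max) simp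
    moreover have "(y /\<^sub>R norm y) \<bullet> (A *v (y /\<^sub>R norm y)) = (y \<bullet> (A *v y)) / (norm y)\<^sup>2"
      by (simp add: matrix_vector_scaleR power2_eq_square field_simps)
    ultimately have "(y \<bullet> (A *v y)) / (norm y)\<^sup>2 \<le> \<nu>" by (simp only:)
    with False show ?thesis by (simp add: pos_divide_le_eq)
  qed simp
  have "d = 0"
  proof (rule ccontr)
    assume d0: "d \<noteq> 0"
    define b where "b = d \<bullet> (A *v d) - \<nu> * (norm d)\<^sup>2"
    have key: "2 * t * (norm d)\<^sup>2 + t\<^sup>2 * b \<le> 0" for t
    proof -
      have "(v + t *\<^sub>R d) \<bullet> (A *v (v + t *\<^sub>R d)) - \<nu> * (norm (v + t *\<^sub>R d))\<^sup>2
          = 2 * t * (d \<bullet> (A *v v) - \<nu> * (v \<bullet> d)) + t\<^sup>2 * b"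
        using hermitian_dot[OF A, of v d] v unfolding b_def
        by (simp add: power2_norm_eq_inner matrix_vector_right_distrib matrix_vector_scaleR
          inner_add inner_commute \<nu>_def algebra_simps power2_eq_square[of t] norm_eq_1)
      also have "d \<bullet> (A *v v) - \<nu> * (v \<bullet> d) = (norm d)\<^sup>2"
        by (simp add: power2_norm_eq_inner d_def inner_diff inner_commute algebra_simps)
      finally show ?thesis using all[of "v + t *\<^sub>R d"] by linarith
    qed
    \<comment> \<open>So small that the second-order term \<open>t\<^sup>2 * b\<close> cancels at
      most half of the first-order gain.\<close>
    define t where "t = (norm d)\<^sup>2 / (\<bar>b\<bar> + 1)"
    have nd: "(norm d)\<^sup>2 > 0" using d0 by simp
    have t: "t > 0" using nd by (simp add: t_def)
    have "t * b \<ge> - (norm d)\<^sup>2"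
    proof -
      have "t * \<bar>b\<bar> \<le> t * (\<bar>b\<bar> + 1)" using t by (intro mult_left_mono) auto
      also have "\<dots> = (norm d)\<^sup>2" by (simp add: t_def field_simps)
      finally show ?thesis using t abs_ge_minus_self[of b] mult_left_mono[of "-b" "\<bar>b\<bar>" t] by linarith
    qed
    then have "t * (2 * (norm d)\<^sup>2 + t * b) > 0" using t nd by (intro mult_pos_pos) linarith+
    with key[of t] show False by (simp add: power2_eq_square algebra_simps)
  qed
  then have "A *v v = of_real \<nu> *s v"
    by (simp add: d_def vec_eq_iff scaleR_conv_of_real[where 'a = complex])
  with v have "eigenpair A (of_real \<nu>) v" by (auto simp: eigenpair_def)
  then show ?thesis using max[OF x] by (auto simp: \<nu>_def)
qed

section \<open>The generalized power method under bounded noise\<close>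

text \<open>The deterministic half of the proof: hermiticity and the last two bounds are all the
  information about the noise that enters here.\<close>

locale phase_sync =
  fixes zs :: "complex ^ 'n" and D :: "complex ^ 'n ^ 'n" and n \<sigma> \<alpha> :: real
  assumes n: "n = real CARD('n)"
    and zs: "cmod (zs $ j) = 1"
    and D_hermitian: "hermitian D"
    and \<sigma>: "0 < \<sigma>" "\<sigma> \<le> sqrt n / 48"
    and \<alpha>: "2 \<le> \<alpha>"
    and D_norm: "norm (D *v x) \<le> 3 * \<sigma> * sqrt n * norm x"
    and D_zs: "cmod ((D *v zs) $ j) \<le> 3 * \<sigma> * sqrt (n * ln n)"
begin

definition C :: "complex ^ 'n ^ 'n" where
  "C = herm_outer zs zs + D"

text \<open>On the torus this is the squared distance to \<open>zs\<close> in the 2-norm, minimised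
  over the phase. Iterates may have zero entries; for these it exceeds the squared distance by n -
  |z|^2, but the correlation with \<open>zs\<close> can still be read off from it exactly.\<close>

definition pot :: "complex ^ 'n \<Rightarrow> real" where
  "pot z = 2 * (n - cmod (herm_inner zs z))"

text \<open>By \<open>D_coord_le\<close>, n times this number bounds every entry of
  \<open>D *v x\<close> for x within 4 \<sigma> of a phase multiple of \<open>zs\<close>.\<close>

definition \<eta> :: real where
  "\<eta> = \<sigma> / sqrt n * (3 * sqrt (ln n) + 12 * \<sigma>)"

lemma n_ge_1: "1 \<le> n"
  using n by (simp add: Suc_le_eq)

lemma n_pos: "0 < n" "0 < sqrt n" "n \<noteq> 0"
  using n_ge_1 by auto

lemma sqrt_n_sqr: "sqrt n * sqrt n = n" "(sqrt n)\<^sup>2 = n"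
  using n_pos by auto

lemma sigma_sqrt_n: "\<sigma> * sqrt n \<le> n / 48"
  using mult_right_mono[OF \<sigma>(2), of "sqrt n"] n_pos sqrt_n_sqr by simp

lemma norm_zs: "(norm zs)\<^sup>2 = n" "norm zs = sqrt n"
proof -
  show "(norm zs)\<^sup>2 = n" by (simp add: norm_vec_sqr zs n)
  then show "norm zs = sqrt n" by (metis norm_ge_zero real_sqrt_unique)
qed

lemma norm_phase_zs: "cmod c = 1 \<Longrightarrow> norm (c *s zs) = sqrt n"
  by (simp add: norm_vec_def L2_set_def norm_mult zs n)

lemma C_mult: "C *v x = herm_inner zs x *s zs + D *v x"
proof (rule vec_eq_iff[THEN iffD2], rule allI)
  fix i
  have "herm_inner zs x * zs $ i = (\<Sum>j\<in>UNIV. zs $ i * cnj (zs $ j) * x $ j)"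
    unfolding herm_inner_def sum_distrib_right by (intro sum.cong refl) (simp only: mult_ac)
  then show "(C *v x) $ i = (herm_inner zs x *s zs + D *v x) $ i"
    by (simp add: C_def matrix_vector_mult_def herm_outer_def distrib_right sum.distrib)
qed

lemma C_hermitian: "hermitian C"
  unfolding hermitian_def
proof (intro allI)
  fix i j
  have "D $ j $ i = cnj (D $ i $ j)" using D_hermitian unfolding hermitian_def by blast
  then show "C $ j $ i = cnj (C $ i $ j)" by (simp add: C_def herm_outer_def)
qed

lemma gpm_step:
  "(mat 1 + (\<alpha> / n) *\<^sub>R C) *v z = z + (\<alpha> / n) *\<^sub>R (herm_inner zs z *s zs + D *v z)"
  by (simp add: matrix_vector_mult_add_rdistrib scaleR_matrix_vector C_mult)

text \<open>The convention \<open>sgn 0 = 0\<close> agrees with the zero branch of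
  \<open>phase_vec\<close>, so \<open>sgn\<close> describes all entries uniformly.\<close>

lemma gpm_Suc: "gpm C \<alpha> z (Suc k) $ j =
    sgn ((gpm C \<alpha> z k + (\<alpha> / n) *\<^sub>R (herm_inner zs (gpm C \<alpha> z k) *s zs + D *v gpm C \<alpha> z k)) $ j)"
  using gpm_step[of "gpm C \<alpha> z k"] by (simp add: phase_vec_def sgn_div_norm n scaleR_conv_of_real[where 'a = complex] field_simps)

text \<open>The decoupling step: x may depend on the noise, but \<open>zs\<close> does not, and a
  phase leaves the moduli of the entries of \<open>D *v zs\<close> unchanged. The remainder is
  bounded by its 2-norm.\<close>

lemma D_coord_le:
  assumes "cmod c = 1"
  shows "cmod ((D *v x) $ j) \<le> 3 * \<sigma> * sqrt (n * ln n) + 3 * \<sigma> * sqrt n * norm (x - c *s zs)"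
proof -
  have "D *v x = D *v (c *s zs + (x - c *s zs))" by simp
  also have "\<dots> = c *s (D *v zs) + D *v (x - c *s zs)"
    by (simp only: matrix_vector_right_distrib vector_scalar_commute)
  finally have "cmod ((D *v x) $ j) \<le> cmod (c * (D *v zs) $ j) + cmod ((D *v (x - c *s zs)) $ j)"
    by (metis norm_triangle_ineq vector_add_component vector_smult_component)
  also have "cmod (c * (D *v zs) $ j) \<le> 3 * \<sigma> * sqrt (n * ln n)"
    using D_zs[of j] assms by (simp add: norm_mult)
  also have "cmod ((D *v (x - c *s zs)) $ j) \<le> 3 * \<sigma> * sqrt n * norm (x - c *s zs)"
    using Finite_Cartesian_Product.norm_nth_le[of "D *v (x - c *s zs)" j] D_norm[of "x - c *s zs"] by linarith
  finally show ?thesis by simp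
qed

lemma norm_diff_sqr: "(norm (z - c *s zs))\<^sup>2 = (norm z)\<^sup>2 + n - 2 * (c \<bullet> herm_inner zs z)"
  if "cmod c = 1"
proof -
  have "(norm (z - c *s zs))\<^sup>2 = (norm z)\<^sup>2 + (norm (c *s zs))\<^sup>2 - 2 * ((c *s zs) \<bullet> z)"
    by (simp add: power2_norm_eq_inner inner_diff inner_commute)
  also have "(norm (c *s zs))\<^sup>2 = n"
    using norm_phase_zs[OF that] sqrt_n_sqr by simp
  also have "(c *s zs) \<bullet> z = Re (cnj c * herm_inner zs z)"
    by (simp add: inner_vec_complex herm_inner_def sum_distrib_left mult.assoc)
  also have "\<dots> = c \<bullet> herm_inner zs z"
    by (simp add: inner_complex_def)
  finally show ?thesis .
qed

lemma norm_sqr_le_n: "(norm z)\<^sup>2 \<le> n" if "\<And>j. cmod (z $ j) \<le> 1" for z :: "complex ^ 'n"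
proof -
  have "(norm z)\<^sup>2 \<le> (\<Sum>j\<in>(UNIV :: 'n set). 1)"
    unfolding norm_vec_sqr by (intro sum_mono) (use that in \<open>simp add: power_le_one\<close>)
  then show ?thesis by (simp add: n)
qed

lemma norm_diff_le_pot:
  assumes "\<And>j. cmod (z $ j) \<le> 1"
  obtains c where "cmod c = 1" "herm_inner zs z = of_real (cmod (herm_inner zs z)) * c"
    "norm (z - c *s zs) \<le> sqrt (pot z)"
proof -
  define h where "h = herm_inner zs z"
  \<comment> \<open>For \<open>h = 0\<close> every phase is equally good, but \<open>sgn 0\<close>
    is not a phase, hence the default 1.\<close>
  define c where "c = (if h = 0 then 1 else sgn h)"
  have c: "cmod c = 1" by (simp add: c_def norm_sgn)
  have h: "h = of_real (cmod h) * c"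
    by (simp add: c_def sgn_div_norm scaleR_conv_of_real[where 'a = complex])
  have "c \<bullet> c = 1" using c by (simp flip: norm_eq_1)
  have "c \<bullet> h = cmod h"
    by (simp add: c_def sgn_div_norm dot_square_norm power2_eq_square)
  then have "(norm (z - c *s zs))\<^sup>2 \<le> pot z"
    using norm_diff_sqr[OF c, of z] norm_sqr_le_n[OF assms] by (simp add: pot_def h_def)
  then have "norm (z - c *s zs) \<le> sqrt (pot z)" by (rule real_le_rsqrt)
  then show ?thesis using that[OF c] h unfolding h_def by metis
qed

lemma phase_dist_le_pot:
  assumes "\<And>j. cmod (z $ j) \<le> 1"
  shows "phase_dist 2 z zs \<le> sqrt (pot z)"
proof -
  obtain c where "cmod c = 1" "norm (z - c *s zs) \<le> sqrt (pot z)"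
    using norm_diff_le_pot[OF assms] by metis
  then show ?thesis using phase_dist_2_le[of c z zs] by linarith
qed

lemma pot_le_phase_dist:
  assumes "\<And>j. cmod (z $ j) = 1"
  shows "sqrt (pot z) \<le> phase_dist 2 z zs"
proof -
  have "(1::ereal) \<le> 2" by (simp add: one_ereal_def)
  from phase_dist_attained[OF this] obtain \<theta> where \<theta>: "phase_dist 2 z zs = norm (z - cis \<theta> *s zs)"
    unfolding lq_norm_2 by metis
  have "(norm z)\<^sup>2 = n" using assms by (simp add: norm_vec_sqr n)
  moreover have "cis \<theta> \<bullet> herm_inner zs z \<le> cmod (herm_inner zs z)"
    using norm_cauchy_schwarz[of "cis \<theta>" "herm_inner zs z"] by simp
  ultimately have "pot z \<le> (norm (z - cis \<theta> *s zs))\<^sup>2"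
    using norm_diff_sqr[of "cis \<theta>" z] by (simp add: pot_def)
  then show ?thesis unfolding \<theta> by (simp add: real_le_lsqrt)
qed

lemma pot_nonneg:
  assumes "\<And>j. cmod (z $ j) \<le> 1"
  shows "0 \<le> pot z"
proof -
  obtain c where "norm (z - c *s zs) \<le> sqrt (pot z)"
    using norm_diff_le_pot[OF assms] by metis
  then have "0 \<le> sqrt (pot z)" by (meson norm_ge_zero order_trans)
  then show ?thesis by simp
qed

section \<open>Contraction in the 2-norm\<close>

text \<open>
  A vanishing entry contributes 1 to the squared distance but 2 to \<^term>\<open>pot\<close>; the bound
  still holds there because its right-hand side is at least 4.
\<close>

lemma pot_le:
  assumes c: "cmod c = 1" and r: "r > 0"
    and z: "\<And>j. 2 - 2 * ((c * zs $ j) \<bullet> z $ j) \<le> (2 * cmod (w $ j - of_real r * (c * zs $ j)) / r)\<^sup>2"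
  shows "sqrt (pot z) \<le> 2 * norm (w - of_real r *s (c *s zs)) / r"
proof -
  have "(\<Sum>j\<in>UNIV. (c * zs $ j) \<bullet> z $ j) = Re (cnj c * herm_inner zs z)"
    by (simp add: inner_complex_def herm_inner_def sum_distrib_left algebra_simps sum.distrib sum_subtractf)
  also have "\<dots> = c \<bullet> herm_inner zs z"
    by (simp add: inner_complex_def)
  also have "\<dots> \<le> cmod (herm_inner zs z)"
    using norm_cauchy_schwarz[of c "herm_inner zs z"] c by simp
  finally have "pot z \<le> 2 * n - 2 * (\<Sum>j\<in>UNIV. (c * zs $ j) \<bullet> z $ j)"
    by (simp add: pot_def)
  also have "\<dots> = (\<Sum>j\<in>UNIV. 2 - 2 * ((c * zs $ j) \<bullet> z $ j))"
    by (simp add: sum_subtractf n flip: sum_distrib_left)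
  also have "\<dots> \<le> (\<Sum>j\<in>UNIV. (2 * cmod (w $ j - of_real r * (c * zs $ j)) / r)\<^sup>2)"
    by (intro sum_mono z)
  also have "\<dots> = (2 / r)\<^sup>2 * (\<Sum>j\<in>UNIV. (cmod (w $ j - of_real r * (c * zs $ j)))\<^sup>2)"
    by (simp add: sum_distrib_left power_divide power_mult_distrib)
  also have "\<dots> = (2 * norm (w - of_real r *s (c *s zs)) / r)\<^sup>2"
    by (simp add: norm_vec_sqr power_divide power_mult_distrib mult.assoc)
  finally show ?thesis
    using r by (intro real_le_lsqrt) auto
qed

text \<open>Before normalisation the signal is \<open>c *s zs\<close> times r = 1 + \<alpha> h / n,
  and the error is d + \<alpha> (3 \<sigma> + d / 16), where d / 16 comes from \<sigma> \<le> sqrt n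
  / 48. Normalising doubles the relative error. Since r \<ge> 1 + 7 \<alpha> / 8, clearing the
  denominator 8 gives the stated coefficients.\<close>

lemma pot_step:
  assumes z: "\<And>j. cmod (z $ j) \<le> 1" and small: "sqrt (pot z) \<le> sqrt n / 2"
    and z': "\<And>j. z' $ j = sgn ((z + (\<alpha> / n) *\<^sub>R (herm_inner zs z *s zs + D *v z)) $ j)"
  shows "sqrt (pot z') \<le> (\<alpha> + 16) / (7 * \<alpha> + 8) * sqrt (pot z) + 48 * \<alpha> / (7 * \<alpha> + 8) * \<sigma>"
proof -
  define d where "d = sqrt (pot z)"
  define h where "h = cmod (herm_inner zs z)"
  define w where "w = z + (\<alpha> / n) *\<^sub>R (herm_inner zs z *s zs + D *v z)"
  obtain c where c: "cmod c = 1" and h: "herm_inner zs z = of_real h * c"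
    and dist: "norm (z - c *s zs) \<le> d"
    using norm_diff_le_pot[OF z] unfolding h_def d_def by metis
  have d0: "0 \<le> d" using dist norm_ge_zero order_trans by blast
  have "d\<^sup>2 \<le> (sqrt n / 2)\<^sup>2" using small d0 unfolding d_def by (intro power_mono)
  then have "d\<^sup>2 \<le> n / 4" using n_pos by (simp add: power_divide)
  moreover have "d\<^sup>2 = 2 * (n - h)"
    using pot_nonneg[OF z] by (simp add: d_def pot_def h_def)
  \<comment> \<open>This is what the assumed radius sqrt n / 2 is for: a potential of at most n / 4
    leaves a correlation of at least 7 n / 8.\<close>
  ultimately have h78: "7 / 8 * n \<le> h" by simp
  define r where "r = 1 + \<alpha> * (h / n)"
  have "7 / 8 \<le> h / n" using h78 n_pos by (simp add: pos_le_divide_eq)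
  then have "\<alpha> * (7 / 8) \<le> \<alpha> * (h / n)" using \<alpha> by (intro mult_left_mono) auto
  then have r: "1 + 7 / 8 * \<alpha> \<le> r" by (simp add: r_def)
  have r0: "r > 0" using r \<alpha> by linarith
  have "sqrt (pot z') \<le> 2 * norm (w - of_real r *s (c *s zs)) / r"
    using c r0
  proof (rule pot_le)
    show "2 - 2 * ((c * zs $ j) \<bullet> z' $ j) \<le> (2 * cmod (w $ j - of_real r * (c * zs $ j)) / r)\<^sup>2" for j
      unfolding z' w_def[symmetric] using r0 c zs by (intro sgn_potential_le) (simp_all add: norm_mult)
  qed
  also have "w - of_real r *s (c *s zs) = (z - c *s zs) + (\<alpha> / n) *\<^sub>R (D *v z)"
    unfolding w_def h r_def by (simp add: vec_eq_iff scaleR_conv_of_real[where 'a = complex] algebra_simps)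
  also have "norm \<dots> \<le> norm (z - c *s zs) + (\<alpha> / n) * norm (D *v z)"
    using norm_triangle_ineq[of "z - c *s zs" "(\<alpha> / n) *\<^sub>R (D *v z)"] \<alpha> n_pos by simp
  also have "norm (D *v z) \<le> 3 * \<sigma> * sqrt n * (sqrt n + d)"
  proof -
    have "norm z \<le> norm (c *s zs) + norm (z - c *s zs)"
      using norm_triangle_ineq[of "c *s zs" "z - c *s zs"] by simp
    then have "norm z \<le> sqrt n + d" using norm_phase_zs[OF c] dist by linarith
    then have "3 * \<sigma> * sqrt n * norm z \<le> 3 * \<sigma> * sqrt n * (sqrt n + d)"
      using \<sigma> n_pos by (intro mult_left_mono) auto
    then show ?thesis using D_norm[of z] by linarith
  qed
  also have "3 * \<sigma> * sqrt n * (sqrt n + d) \<le> n * (3 * \<sigma> + d / 16)"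
  proof -
    have "3 * \<sigma> * sqrt n * (sqrt n + d) = 3 * \<sigma> * n + 3 * (\<sigma> * sqrt n) * d"
      using sqrt_n_sqr by (simp add: algebra_simps)
    also have "\<dots> \<le> 3 * \<sigma> * n + 3 * (n / 48) * d"
      using sigma_sqrt_n d0 by (intro add_left_mono mult_right_mono mult_left_mono) auto
    finally show ?thesis by (simp add: algebra_simps)
  qed
  also have "norm (z - c *s zs) + \<alpha> / n * (n * (3 * \<sigma> + d / 16)) \<le> d + \<alpha> * (3 * \<sigma> + d / 16)"
    using dist n_pos by simp
  finally have "sqrt (pot z') \<le> 2 * (d + \<alpha> * (3 * \<sigma> + d / 16)) / r"
    using \<alpha> n_pos r0 by (simp add: divide_right_mono mult_left_mono)
  also have "\<dots> \<le> 2 * (d + \<alpha> * (3 * \<sigma> + d / 16)) / (1 + 7 / 8 * \<alpha>)"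
    using r \<alpha> d0 \<sigma> by (intro divide_left_mono mult_pos_pos) (auto intro!: add_nonneg_nonneg mult_nonneg_nonneg)
  also have "\<dots> = (\<alpha> + 16) / (7 * \<alpha> + 8) * d + 48 * \<alpha> / (7 * \<alpha> + 8) * \<sigma>"
  proof -
    have "7 * \<alpha> + 8 > 0" "1 + 7 / 8 * \<alpha> > 0" using \<alpha> by auto
    then show ?thesis by (simp add: divide_simps) (simp add: algebra_simps)
  qed
  finally show ?thesis unfolding d_def .
qed

text \<open>The limiting error is the fixed point of the affine recursion in
  \<open>pot_step\<close>: dividing 48 \<alpha> by (7 \<alpha> + 8) - (\<alpha> + 16) = 6 \<alpha> -
  8 gives 24 \<alpha> / (3 \<alpha> - 4).\<close>

lemma contraction_fixpoint:
  "(\<alpha> + 16) / (7 * \<alpha> + 8) * (24 * \<alpha> / (3 * \<alpha> - 4) * \<sigma>) + 48 * \<alpha> / (7 * \<alpha> + 8) * \<sigma>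
    = 24 * \<alpha> / (3 * \<alpha> - 4) * \<sigma>"
proof -
  have "7 * \<alpha> + 8 \<noteq> 0" "3 * \<alpha> - 4 \<noteq> 0" using \<alpha> by auto
  then show ?thesis by (simp add: divide_simps) (simp add: algebra_simps)
qed

text \<open>The factor 24 \<alpha> / (3 \<alpha> - 4) decreases in \<alpha> and equals 24 at
  \<alpha> = 2; the bound on \<sigma> does the rest.\<close>

lemma fixpoint_le: "24 * \<alpha> / (3 * \<alpha> - 4) * \<sigma> \<le> sqrt n / 2"
proof -
  have "24 * \<alpha> / (3 * \<alpha> - 4) \<le> 24"
    using \<alpha> by (simp add: divide_simps)
  then have "24 * \<alpha> / (3 * \<alpha> - 4) * \<sigma> \<le> 24 * \<sigma>"
    using \<sigma> by (intro mult_right_mono) auto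
  then show ?thesis using \<sigma> by simp
qed

lemma n_eta: "n * \<eta> = 3 * \<sigma> * sqrt (n * ln n) + 3 * \<sigma> * sqrt n * (4 * \<sigma>)"
proof -
  have "n * \<eta> = (n / sqrt n) * (\<sigma> * (3 * sqrt (ln n) + 12 * \<sigma>))"
    by (simp add: \<eta>_def)
  also have "n / sqrt n = sqrt n" using n_pos by (simp add: real_div_sqrt)
  finally show ?thesis by (simp add: real_sqrt_mult algebra_simps)
qed

lemma rho_bounds: "0 \<le> (\<alpha> + 16) / (7 * \<alpha> + 8)" "(\<alpha> + 16) / (7 * \<alpha> + 8) \<le> 1"
  using \<alpha> by (auto simp: divide_simps)

lemma gpm_cmod_le:
  assumes "\<And>j. cmod (z0 $ j) = 1"
  shows "cmod (gpm C \<alpha> z0 k $ j) \<le> 1"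
  using assms by (cases k) (auto simp: gpm_Suc norm_sgn simp del: gpm.simps(2))

lemma gpm_dist_2_le:
  assumes z0: "\<And>j. cmod (z0 $ j) = 1" and small: "sqrt (pot z0) \<le> sqrt n / 2"
  shows "phase_dist 2 (gpm C \<alpha> z0 k) zs
    \<le> ((\<alpha> + 16) / (7 * \<alpha> + 8)) ^ k * phase_dist 2 z0 zs + 24 * \<alpha> / (3 * \<alpha> - 4) * \<sigma>"
proof -
  define B where "B = 24 * \<alpha> / (3 * \<alpha> - 4) * \<sigma>"
  define \<rho> where "\<rho> = (\<alpha> + 16) / (7 * \<alpha> + 8)"
  define P where "P k = sqrt (pot (gpm C \<alpha> z0 k))" for k
  have \<rho>: "0 \<le> \<rho>" "\<rho> \<le> 1" using rho_bounds by (auto simp: \<rho>_def)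
  have B: "B \<le> sqrt n / 2" using fixpoint_le by (simp add: B_def)
  \<comment> \<open>The first conjunct keeps \<open>pot_step\<close> applicable: the next value is
    at most a convex combination of \<open>P k\<close> and \<open>B\<close>, both at most sqrt n /
    2.\<close>
  have "P k \<le> sqrt n / 2 \<and> P k \<le> \<rho> ^ k * P 0 + B"
  proof (induction k)
    case 0
    have "0 \<le> B" using \<alpha> \<sigma> by (simp add: B_def)
    then show ?case using small by (simp add: P_def)
  next
    case (Suc k)
    have "P (Suc k) \<le> \<rho> * P k + 48 * \<alpha> / (7 * \<alpha> + 8) * \<sigma>"
      unfolding P_def \<rho>_def
      using gpm_cmod_le[OF z0] Suc.IH[unfolded P_def] by (intro pot_step) (auto simp: gpm_Suc simp del: gpm.simps(2))
    also have "\<dots> = \<rho> * P k + (B - \<rho> * B)"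
      using contraction_fixpoint unfolding B_def \<rho>_def by linarith
    finally have step: "P (Suc k) \<le> \<rho> * P k + (B - \<rho> * B)" .
    have "\<rho> * P k \<le> \<rho> * (sqrt n / 2)" using Suc.IH \<rho> by (intro mult_left_mono) auto
    moreover have "(1 - \<rho>) * B \<le> (1 - \<rho>) * (sqrt n / 2)" using \<rho> B by (intro mult_left_mono) auto
    ultimately have "P (Suc k) \<le> sqrt n / 2"
      using step by (simp add: algebra_simps)
    moreover have "\<rho> * P k \<le> \<rho> * (\<rho> ^ k * P 0 + B)" using Suc.IH \<rho> by (intro mult_left_mono) auto
    ultimately show ?case using step by (simp add: algebra_simps)
  qed
  moreover have "phase_dist 2 (gpm C \<alpha> z0 k) zs \<le> P k"
    unfolding P_def by (intro phase_dist_le_pot gpm_cmod_le z0)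
  moreover have "P 0 \<le> phase_dist 2 z0 zs"
    unfolding P_def gpm.simps(1) by (rule pot_le_phase_dist[OF z0])
  then have "\<rho> ^ k * P 0 \<le> \<rho> ^ k * phase_dist 2 z0 zs"
    using \<rho> by (intro mult_left_mono) auto
  ultimately show ?thesis unfolding B_def[symmetric] \<rho>_def[symmetric] by linarith
qed

section \<open>The eigenvector estimator\<close>

text \<open>
  The leading eigenvector \<open>u\<close>, scaled by \<open>\<mu> / (zs\<^sup>H u)\<close>, is \<open>zs + D x / n\<close> for a vector \<open>x\<close>
  close to \<open>zs\<close>, so its phases are controlled entrywise.
\<close>

lemma eigenvector_estimator_close:
  assumes est: "eigenvector_estimator C z0"
  obtains c w where "cmod c = 1" "\<And>j. cmod (z0 $ j) = 1"
    "\<And>j. w $ j \<noteq> 0 \<Longrightarrow> z0 $ j = c * sgn (w $ j)"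
    "norm (w - zs) \<le> 45 / 14 * \<sigma>" "\<And>j. cmod (w $ j - zs $ j) \<le> \<eta>"
proof -
  obtain u a where lead: "leading_eigenvector C u" and a: "herm_inner a u \<noteq> 0"
    and z0: "z0 = eigenvector_phases a u"
    using est unfolding eigenvector_estimator_def by blast
  obtain \<mu> :: real where eig: "eigenpair C (of_real \<mu>) u"
    and max: "\<And>(\<nu>::real) v. eigenpair C (of_real \<nu>) v \<Longrightarrow> \<nu> \<le> \<mu>"
    using lead unfolding leading_eigenvector_def by blast
  define \<beta> where "\<beta> = 3 * \<sigma> * sqrt n"
  have \<beta>: "0 < \<beta>" "\<beta> \<le> n / 16"
    using \<sigma> n_pos sigma_sqrt_n by (auto simp: \<beta>_def)
  \<comment> \<open>The Rayleigh quotient at the normalised ground truth is n up to the operator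
    norm of the noise.\<close>
  have "\<mu> \<ge> n - \<beta>"
  proof -
    define x where "x = zs /\<^sub>R sqrt n"
    have "norm x = 1" using n_pos by (simp add: x_def norm_zs)
    from hermitian_eigenvalue_ge[OF C_hermitian this] obtain \<nu> v where
      "eigenpair C (of_real \<nu>) v" "x \<bullet> (C *v x) \<le> \<nu>" by blast
    with max have "x \<bullet> (C *v x) \<le> \<mu>" by force
    moreover have "x \<bullet> (C *v x) = (zs \<bullet> (C *v zs)) / n"
      using n_pos sqrt_n_sqr by (simp add: x_def matrix_vector_scaleR field_simps)
    moreover have "zs \<bullet> (C *v zs) = n * n + zs \<bullet> (D *v zs)"
    proof -
      have h: "herm_inner zs zs = of_real n"
        by (simp add: herm_inner_def mult.commute[of "cnj _"] complex_norm_square[symmetric] zs n)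
      have "herm_inner zs zs *s zs = n *\<^sub>R zs"
        unfolding h by (simp add: vec_eq_iff scaleR_conv_of_real[where 'a = complex])
      then show ?thesis
        using norm_zs(1) by (simp add: C_mult inner_add power2_norm_eq_inner)
    qed
    moreover have "\<bar>zs \<bullet> (D *v zs)\<bar> \<le> n * \<beta>"
    proof -
      have "norm zs * norm (D *v zs) \<le> sqrt n * (\<beta> * sqrt n)"
        using D_norm[of zs] n_pos unfolding norm_zs(2) \<beta>_def by (intro mult_left_mono) auto
      also have "\<dots> = (sqrt n * sqrt n) * \<beta>" by simp
      finally show ?thesis
        using Cauchy_Schwarz_ineq2[of zs "D *v zs"] unfolding sqrt_n_sqr(1) by linarith
    qed
    ultimately have "(n * n - n * \<beta>) / n \<le> \<mu>"
      using n_pos by (smt (verit) divide_right_mono)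
    moreover have "(n * n - n * \<beta>) / n = n - \<beta>" using n_pos by (simp add: field_simps)
    ultimately show ?thesis by simp
  qed
  then have \<mu>: "\<mu> - \<beta> \<ge> 7 / 8 * n" "\<mu> > 0" "\<mu> > \<beta>" using \<beta> n_pos by auto
  define G where "G = herm_inner zs u"
  have u0: "u \<noteq> 0" and Cu: "G *s zs + D *v u = of_real \<mu> *s u"
    using eig by (auto simp: eigenpair_def C_mult G_def)
  have G0: "G \<noteq> 0"
  proof
    assume "G = 0"
    then have "D *v u = of_real \<mu> *s u" using Cu by simp
    also have "\<dots> = \<mu> *\<^sub>R u" by (simp add: vec_eq_iff scaleR_conv_of_real[where 'a = complex])
    finally have "\<mu> * norm u \<le> \<beta> * norm u" using D_norm[of u] \<mu> by (simp add: \<beta>_def)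
    with \<mu> u0 show False by simp
  qed
  define x where "x = (of_real n / G) *s u"
  have xeq: "n *\<^sub>R zs + D *v x = \<mu> *\<^sub>R x"
  proof -
    have "(of_real n / G) *s (G *s zs + D *v u) = (of_real n / G) *s (of_real \<mu> *s u)"
      by (simp add: Cu)
    then have "of_real n *s zs + D *v x = of_real \<mu> *s x"
      using G0 by (simp add: x_def vector_add_ldistrib vector_scalar_commute mult.commute)
    then show ?thesis by (simp add: vec_eq_iff scaleR_conv_of_real[where 'a = complex])
  qed
  define p where "p = x - zs"
  have hx: "zs \<bullet> x = n"
  proof -
    have "herm_inner zs x = of_real n / G * herm_inner zs u"
      by (simp add: x_def herm_inner_def sum_distrib_left mult_ac)
    then show ?thesis using G0 by (simp add: inner_vec_complex G_def)
  qed
  have pzs: "p \<bullet> zs = 0"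
    using hx norm_zs(1) by (simp add: p_def inner_diff inner_commute power2_norm_eq_inner)
  have xp: "x = zs + p" by (simp add: p_def)
  have nx: "norm x \<le> sqrt n + norm p"
    using norm_triangle_ineq[of zs p] by (simp add: xp norm_zs)
  \<comment> \<open>Testing the eigenvalue equation against p removes \<open>zs\<close> from both
    sides. What remains, \<mu> |p|^2 \<le> \<beta> |p| (sqrt n + |p|), is solved for |p| using \<mu>
    - \<beta> \<ge> 7 n / 8.\<close>
  have np: "norm p \<le> 24 / 7 * \<sigma>"
  proof -
    have "\<mu> * (norm p)\<^sup>2 = p \<bullet> (\<mu> *\<^sub>R x)"
      using pzs by (simp add: xp inner_add power2_norm_eq_inner)
    also have "\<dots> = p \<bullet> (D *v x)"
      using pzs by (simp add: xeq[symmetric] inner_add)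
    also have "\<dots> \<le> norm p * norm (D *v x)" by (rule norm_cauchy_schwarz)
    also have "\<dots> \<le> norm p * (\<beta> * (sqrt n + norm p))"
      using D_norm[of x] mult_left_mono[OF nx, of \<beta>] \<beta>
      by (intro mult_left_mono) (auto simp: \<beta>_def)
    finally have "norm p * (\<mu> * norm p) \<le> norm p * (\<beta> * (sqrt n + norm p))"
      by (simp add: power2_eq_square algebra_simps)
    then have "\<mu> * norm p \<le> \<beta> * (sqrt n + norm p) \<or> norm p = 0"
      using mult_le_cancel_left_pos[of "norm p"] by fastforce
    then have "(\<mu> - \<beta>) * norm p \<le> \<beta> * sqrt n"
      using \<beta> n_pos by (auto simp: algebra_simps)
    moreover have "7 / 8 * n * norm p \<le> (\<mu> - \<beta>) * norm p"
      using \<mu> by (intro mult_right_mono) auto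
    moreover have "\<beta> * sqrt n = n * (3 * \<sigma>)" using sqrt_n_sqr by (simp add: \<beta>_def)
    ultimately have "n * (7 / 8 * norm p) \<le> n * (3 * \<sigma>)" by (simp add: algebra_simps)
    then show ?thesis using n_pos by simp
  qed
  define w where "w = zs + (1 / n) *\<^sub>R (D *v x)"
  have wx: "w = (\<mu> / n) *\<^sub>R x"
  proof -
    have "w = (1 / n) *\<^sub>R (n *\<^sub>R zs + D *v x)"
      using n_pos by (simp add: w_def scaleR_add_right)
    then show ?thesis by (simp add: xeq)
  qed
  have wu: "w $ j = of_real \<mu> * u $ j / G" for j
    using n_pos by (simp add: wx x_def scaleR_conv_of_real[where 'a = complex])
  define c where "c = sgn G"
  have c: "cmod c = 1" using G0 by (simp add: c_def norm_sgn)
  show ?thesis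
  proof
    show "cmod c = 1" by (rule c)
    show "cmod (z0 $ j) = 1" for j
      using a by (simp add: z0 eigenvector_phases_def norm_divide)
    show "z0 $ j = c * sgn (w $ j)" if "w $ j \<noteq> 0" for j
    proof -
      have "u $ j \<noteq> 0" using that \<mu> G0 by (simp add: wu)
      then have "z0 $ j = sgn (u $ j)"
        by (simp add: z0 eigenvector_phases_def sgn_div_norm scaleR_conv_of_real field_simps)
      moreover have "sgn (w $ j) = sgn (u $ j) / sgn G"
        unfolding wu using \<mu> G0 by (simp add: sgn_divide sgn_mult sgn_of_real)
      ultimately show ?thesis using G0 by (simp add: c_def sgn_zero_iff)
    qed
    have "norm (w - zs) = norm (D *v x) / n"
      using n_pos by (simp add: w_def)
    also have "norm (D *v x) \<le> \<beta> * (sqrt n + 24 / 7 * \<sigma>)"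
    proof -
      have "\<beta> * norm x \<le> \<beta> * (sqrt n + 24 / 7 * \<sigma>)"
        using nx np \<beta> by (intro mult_left_mono) auto
      then show ?thesis using D_norm[of x] by (simp add: \<beta>_def)
    qed
    also have "\<beta> * (sqrt n + 24 / 7 * \<sigma>) \<le> \<beta> * (15 / 14 * sqrt n)"
      using \<sigma> \<beta> by (intro mult_left_mono) auto
    also have "\<beta> * (15 / 14 * sqrt n) / n = 45 / 14 * \<sigma>"
      using n_pos sqrt_n_sqr by (simp add: \<beta>_def field_simps)
    finally show "norm (w - zs) \<le> 45 / 14 * \<sigma>"
      using n_pos by (simp add: divide_right_mono)
    show "cmod (w $ j - zs $ j) \<le> \<eta>" for j
    proof -
      have "cmod (w $ j - zs $ j) = cmod ((D *v x) $ j) / n"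
        using n_pos by (simp add: w_def)
      also have "cmod ((D *v x) $ j) \<le> 3 * \<sigma> * sqrt (n * ln n) + 3 * \<sigma> * sqrt n * norm p"
        using D_coord_le[of 1 x j] by (simp add: p_def)
      also have "\<dots> \<le> 3 * \<sigma> * sqrt (n * ln n) + 3 * \<sigma> * sqrt n * (4 * \<sigma>)"
        using np \<sigma> n_pos by (intro add_left_mono mult_left_mono) auto
      also have "\<dots> = n * \<eta>"
        by (rule n_eta[symmetric])
      finally show ?thesis using n_pos by (simp add: divide_right_mono)
    qed
  qed
qed

lemma estimator_pot_le:
  assumes "eigenvector_estimator C z0"
  shows "sqrt (pot z0) \<le> sqrt n / 2"
proof -
  obtain c w where c: "cmod c = 1" and z0: "\<And>j. cmod (z0 $ j) = 1"
    and sg: "\<And>j. w $ j \<noteq> 0 \<Longrightarrow> z0 $ j = c * sgn (w $ j)"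
    and w: "norm (w - zs) \<le> 45 / 14 * \<sigma>"
    using eigenvector_estimator_close[OF assms] by metis
  have "sqrt (pot z0) \<le> 2 * norm (c *s w - of_real 1 *s (c *s zs)) / 1"
    using c zero_less_one
  proof (rule pot_le)
    fix j
    show "2 - 2 * ((c * zs $ j) \<bullet> z0 $ j) \<le> (2 * cmod ((c *s w) $ j - of_real 1 * (c * zs $ j)) / 1)\<^sup>2"
    proof (cases "w $ j = 0")
      \<comment> \<open>Here the phase of \<open>z0 $ j\<close> is the arbitrary default. The right
        side is 4, the largest value that the left side can take.\<close>
      case True
      have "- ((c * zs $ j) \<bullet> z0 $ j) \<le> 1"
        using norm_cauchy_schwarz[of "- (c * zs $ j)" "z0 $ j"] c zs[of j] z0[of j] by (simp add: norm_mult)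
      then show ?thesis using True c zs[of j] by (simp add: norm_mult)
    next
      case False
      have "sgn (c * w $ j) = c * sgn (w $ j)"
        using c by (simp add: sgn_mult sgn_div_norm[of c])
      then show ?thesis
        using sgn_potential_le[of "c * zs $ j" 1 "c * w $ j"] sg[OF False] c zs[of j] by (simp add: norm_mult)
    qed
  qed
  also have "c *s w - of_real 1 *s (c *s zs) = c *s (w - zs)"
    by (simp add: vec_eq_iff algebra_simps)
  also have "norm (c *s (w - zs)) = norm (w - zs)"
    using c by (simp add: norm_vec_def L2_set_def norm_mult flip: right_diff_distrib)
  finally show ?thesis using w \<sigma> by simp
qed

section \<open>Errors in the maximum norm\<close>

definition T :: real where
  "T = 48 * \<alpha> / (7 * \<alpha> + 8) * (sqrt (ln n) + 24 * \<alpha> / (3 * \<alpha> - 4) * \<sigma>) * (\<sigma> / sqrt n)"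

text \<open>The factor (7 \<alpha> + 8) / 16 turns the leading coefficient of \<open>T\<close> into
  3 \<alpha>. The rest is a comparison of 4 \<sigma> in \<eta> with 24 \<alpha> / (3 \<alpha> - 4)
  times \<sigma> in \<open>T\<close>.\<close>

lemma eta_le_T: "\<alpha> * \<eta> \<le> (7 * \<alpha> + 8) / 16 * T"
proof -
  have "4 \<le> 24 * \<alpha> / (3 * \<alpha> - 4)" using \<alpha> by (simp add: divide_simps)
  then have "4 * \<sigma> \<le> 24 * \<alpha> / (3 * \<alpha> - 4) * \<sigma>" using \<sigma> by (intro mult_right_mono) auto
  then have "3 * sqrt (ln n) + 12 * \<sigma> \<le> 3 * (sqrt (ln n) + 24 * \<alpha> / (3 * \<alpha> - 4) * \<sigma>)" by simp
  then have "\<alpha> * \<eta> \<le> \<alpha> * (\<sigma> / sqrt n * (3 * (sqrt (ln n) + 24 * \<alpha> / (3 * \<alpha> - 4) * \<sigma>)))"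
    unfolding \<eta>_def using \<sigma> \<alpha> n_pos by (intro mult_left_mono) auto
  also have "\<dots> = (7 * \<alpha> + 8) / 16 * T"
  proof -
    have "(7 * \<alpha> + 8) / 16 * (48 * \<alpha> / (7 * \<alpha> + 8)) = 3 * \<alpha>"
      using \<alpha> by (simp add: divide_simps)
    moreover have "(7 * \<alpha> + 8) / 16 * T = (7 * \<alpha> + 8) / 16 * (48 * \<alpha> / (7 * \<alpha> + 8)) *
        (sqrt (ln n) + 24 * \<alpha> / (3 * \<alpha> - 4) * \<sigma>) * (\<sigma> / sqrt n)"
      unfolding T_def by (simp only: mult.assoc)
    ultimately show ?thesis by (simp only: mult_ac)
  qed
  finally show ?thesis .
qed

lemma eta_nonneg: "0 \<le> \<eta>"
  using \<sigma> n_ge_1 by (simp add: \<eta>_def)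

text \<open>The tangent to ln at 5/2 lies below 2 y / 5 because 5/2 \<le> e; here y is the fourth
  root of x. A fourth root is wanted because in \<open>eta_le\<close> only \<sigma> / sqrt n and s =
  \<sigma>^2 / sqrt n are under control, and (\<sigma> / sqrt n)^2 times the fourth root of n is
  exactly (\<sigma> / sqrt n) sqrt s.\<close>

lemma ln_le_fourth_root: "ln x \<le> 8 / 5 * sqrt (sqrt x)" if "1 \<le> x" for x :: real
proof -
  define y where "y = sqrt (sqrt x)"
  have y: "y \<ge> 1" using that by (simp add: y_def)
  have "x = y ^ 4"
    using that by (simp add: y_def power4_eq_xxxx mult.assoc flip: power2_eq_square)
  then have "ln x = 4 * ln y" using y by (simp add: ln_realpow)
  moreover have "ln (y / (5 / 2)) \<le> y / (5 / 2) - 1" using y by (intro ln_le_minus_one) auto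
  moreover have "ln (y / (5 / 2)) = ln y - ln (5 / 2)" by (intro ln_divide_pos) (use y in auto)
  moreover have "ln (5 / 2 :: real) \<le> 1"
  proof -
    have "(5 / 2 :: real) \<le> exp 1"
      using exp_lower_Taylor_quadratic[of "1::real"] by simp
    then have "ln (5 / 2 :: real) \<le> ln (exp 1)" by (subst ln_le_cancel_iff) auto
    then show ?thesis by simp
  qed
  ultimately show ?thesis unfolding y_def by simp
qed

text \<open>The two parts of \<eta> are bounded separately. The quadratic part of \<open>T\<close>
  forces \<sigma>^2 / sqrt n \<le> 7/192; the logarithmic part then follows from
  \<open>ln_le_fourth_root\<close> together with \<sigma> / sqrt n \<le> 1/48.\<close>

lemma eta_le:
  assumes "T < 2"
  shows "\<eta> \<le> 68 / 100"
proof -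
  define y where "y = \<sigma> / sqrt n"
  have y: "0 < y" "y \<le> 1 / 48"
    using \<sigma> n_pos by (auto simp: y_def field_simps)
  have \<sigma>y: "\<sigma> = y * sqrt n" using n_pos by (simp add: y_def)
  define s where "s = y * \<sigma>"
  have s0: "0 < s" using y \<sigma> by (simp add: s_def)
  have "384 / 7 * s \<le> T"
  proof -
    \<comment> \<open>The value 384/7 = 1152/21 is the limit of the right side for large
      \<alpha>.\<close>
    have "384 / 7 \<le> 48 * \<alpha> / (7 * \<alpha> + 8) * (24 * \<alpha> / (3 * \<alpha> - 4))"
    proof -
      have "(7 * \<alpha> + 8) * (3 * \<alpha> - 4) \<le> 21 * \<alpha>\<^sup>2"
        using \<alpha> by (simp add: algebra_simps power2_eq_square)
      then have "384 / 7 * ((7 * \<alpha> + 8) * (3 * \<alpha> - 4)) \<le> 1152 * \<alpha>\<^sup>2" by linarith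
      moreover have "0 < (7 * \<alpha> + 8) * (3 * \<alpha> - 4)" using \<alpha> by (intro mult_pos_pos) auto
      ultimately have "384 / 7 \<le> 1152 * \<alpha>\<^sup>2 / ((7 * \<alpha> + 8) * (3 * \<alpha> - 4))"
        by (simp only: pos_le_divide_eq)
      then show ?thesis by (simp add: power2_eq_square mult.commute)
    qed
    then have "384 / 7 * s \<le> 48 * \<alpha> / (7 * \<alpha> + 8) * (24 * \<alpha> / (3 * \<alpha> - 4)) * s"
      using s0 by (intro mult_right_mono) auto
    also have "\<dots> = 48 * \<alpha> / (7 * \<alpha> + 8) * (24 * \<alpha> / (3 * \<alpha> - 4) * \<sigma>) * y"
      by (simp add: s_def)
    also have "\<dots> \<le> T"
      unfolding T_def y_def[symmetric] using y \<alpha> n_ge_1 by (intro mult_right_mono mult_left_mono) auto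
    finally show ?thesis .
  qed
  then have s: "s \<le> 7 / 192" using assms by simp
  have sq: "sqrt s \<le> 191 / 1000"
    using s by (intro real_le_lsqrt) (auto simp: power2_eq_square)
  define Y where "Y = y * sqrt (ln n)"
  have "Y\<^sup>2 = y\<^sup>2 * ln n" using n_ge_1 by (simp add: Y_def power_mult_distrib)
  also have "\<dots> \<le> y\<^sup>2 * (8 / 5 * sqrt (sqrt n))"
    by (intro mult_left_mono ln_le_fourth_root n_ge_1) auto
  also have "\<dots> = 8 / 5 * y * sqrt s"
    using y by (simp add: s_def \<sigma>y real_sqrt_mult power2_eq_square flip: mult.assoc)
  also have "\<dots> \<le> 8 / 5 * (1 / 48) * (191 / 1000)"
    using y sq s0 by (intro mult_mono) auto
  also have "\<dots> \<le> (8 / 100)\<^sup>2" by (simp add: power2_eq_square)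
  finally have "Y \<le> 8 / 100" by (rule power2_le_imp_le) simp
  moreover have "\<eta> = 3 * Y + 12 * s"
    unfolding \<eta>_def y_def[symmetric] by (simp add: Y_def s_def algebra_simps)
  ultimately show ?thesis using s by simp
qed

text \<open>The first bound makes \<open>sgn_diff_le'\<close> applicable to every entry, the second
  says that the radius \<delta> survives a step. The cap at 1 is for \<open>T\<close> between 1 and
  2, where a radius \<open>T\<close> could violate the relative error 4/5. The number 287/288 is 1 -
  (1/12)^2 / 2, the correlation left by a distance of 4 \<sigma> \<le> sqrt n / 12.\<close>

lemma step_constants:
  assumes "T < 2" and \<delta>: "\<delta> = min T 1"
  shows "\<delta> + \<alpha> * \<eta> \<le> 4 / 5 * (1 + 287 / 288 * \<alpha>)"
    and "11181 / 10000 * (\<delta> + \<alpha> * \<eta>) \<le> \<delta> * (1 + 287 / 288 * \<alpha>)"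
proof -
  have "\<alpha> * \<eta> \<le> \<alpha> * (68 / 100)"
    using eta_le[OF assms(1)] \<alpha> by (intro mult_left_mono) auto
  note a\<eta> = this
  then show "\<delta> + \<alpha> * \<eta> \<le> 4 / 5 * (1 + 287 / 288 * \<alpha>)"
  proof -
    assume "\<alpha> * \<eta> \<le> \<alpha> * (68 / 100)"
    moreover have "\<delta> \<le> 1" using \<delta> by simp
    moreover have "1 + \<alpha> * (68 / 100) \<le> 4 / 5 * (1 + 287 / 288 * \<alpha>)" using \<alpha> by simp
    ultimately show ?thesis by linarith
  qed
  show "11181 / 10000 * (\<delta> + \<alpha> * \<eta>) \<le> \<delta> * (1 + 287 / 288 * \<alpha>)"
  proof (cases "T \<le> 1")
    case False
    have "11181 / 10000 * (1 + \<alpha> * \<eta>) \<le> 11181 / 10000 * (1 + \<alpha> * (68 / 100))"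
      by (intro mult_left_mono add_left_mono a\<eta>) simp
    also have "\<dots> \<le> 1 + 287 / 288 * \<alpha>" using \<alpha> by simp
    finally show ?thesis using False \<delta> by simp
  next
    case True
    have T0: "0 \<le> T"
      using eta_le_T mult_nonneg_nonneg[OF _ eta_nonneg, of \<alpha>] \<alpha>
      by (smt (verit) mult_pos_neg divide_pos_pos)
    have "11181 / 10000 * (T + \<alpha> * \<eta>) \<le> 11181 / 10000 * (T + (7 * \<alpha> + 8) / 16 * T)"
      by (intro mult_left_mono add_left_mono eta_le_T) simp
    also have "\<dots> = T * (11181 / 10000 * (1 + (7 * \<alpha> + 8) / 16))" by (simp add: algebra_simps)
    also have "\<dots> \<le> T * (1 + 287 / 288 * \<alpha>)"
      using T0 \<alpha> by (intro mult_left_mono) (simp_all add: field_simps)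
    finally show ?thesis using True \<delta> by simp
  qed
qed

text \<open>The invariant of the iteration when \<open>T < 2\<close>. The bound in the 2-norm feeds
  \<open>D_coord_le\<close>, so that the noise contributes at most \<alpha> \<eta> to each entry
  before normalisation.\<close>

definition near :: "complex ^ 'n \<Rightarrow> complex \<Rightarrow> bool" where
  "near z m \<longleftrightarrow> cmod m = 1 \<and> (\<forall>j. cmod (z $ j) = 1) \<and> norm (z - m *s zs) \<le> 4 * \<sigma> \<and>
    (\<forall>j. cmod (z $ j - m * zs $ j) \<le> min T 1)"

lemma norm_sgn_diff_le:
  fixes w z' :: "complex ^ 'n"
  assumes u: "u \<noteq> 0" and w: "\<And>j. cmod (w $ j - u * zs $ j) \<le> 4 / 5 * cmod u"
  shows "cmod (sgn (w $ j) - sgn u * zs $ j) \<le> 11181 / 10000 * (cmod (w $ j - u * zs $ j) / cmod u)"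
    and "w $ j \<noteq> 0"
    and "(\<And>j. z' $ j = sgn (w $ j)) \<Longrightarrow>
      norm (z' - sgn u *s zs) \<le> 11181 / 10000 * (norm (w - u *s zs) / cmod u)"
proof -
  have s: "sgn (u * zs $ j) = sgn u * zs $ j" for j
    by (simp add: sgn_mult sgn_div_norm[of "zs $ j"] zs)
  have nz: "u * zs $ j \<noteq> 0" for j
    using u zs[of j] by auto
  have c: "cmod (u * zs $ j) = cmod u" for j by (simp add: norm_mult zs)
  have *: "cmod (sgn (w $ j) - sgn u * zs $ j) \<le> 11181 / 10000 * (cmod (w $ j - u * zs $ j) / cmod u)" for j
    using sgn_diff_le'[OF nz, of "w $ j" j] w[of j] by (simp only: s c)
  then show "cmod (sgn (w $ j) - sgn u * zs $ j) \<le> 11181 / 10000 * (cmod (w $ j - u * zs $ j) / cmod u)" .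
  show "w $ j \<noteq> 0"
    by (rule sgn_diff_le(1)[OF nz[of j]]) (use w[of j] in \<open>simp only: c\<close>)
  assume z': "\<And>j. z' $ j = sgn (w $ j)"
  have "(norm (z' - sgn u *s zs))\<^sup>2 = (\<Sum>j\<in>UNIV. (cmod (sgn (w $ j) - sgn u * zs $ j))\<^sup>2)"
    by (simp add: norm_vec_sqr z')
  also have "\<dots> \<le> (\<Sum>j\<in>UNIV. (11181 / 10000 * (cmod (w $ j - u * zs $ j) / cmod u))\<^sup>2)"
    by (intro sum_mono power_mono *) auto
  also have "\<dots> = (11181 / 10000 * (norm (w - u *s zs) / cmod u))\<^sup>2"
    by (simp add: norm_vec_sqr power_mult_distrib power_divide sum_distrib_left sum_divide_distrib)
  finally show "norm (z' - sgn u *s zs) \<le> 11181 / 10000 * (norm (w - u *s zs) / cmod u)"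
    by (rule power2_le_imp_le) simp
qed

text \<open>
  The reference phase moves along: the entries of the new iterate are compared with the phase of
  \<open>m + \<alpha> g\<close>, where \<open>g\<close> is the mean of the phases of the old iterate relative to \<open>zs\<close>.
\<close>

lemma near_step:
  assumes T2: "T < 2" and near: "near z m"
    and z': "\<And>j. z' $ j = sgn ((z + (\<alpha> / n) *\<^sub>R (herm_inner zs z *s zs + D *v z)) $ j)"
  shows "\<exists>m'. near z' m'"
proof -
  define w where "w = z + (\<alpha> / n) *\<^sub>R (herm_inner zs z *s zs + D *v z)"
  define u where "u = m + of_real (\<alpha> / n) * herm_inner zs z"
  define R where "R = 1 + 287 / 288 * \<alpha>"
  define \<delta> where "\<delta> = min T 1"
  have m: "cmod m = 1" and z: "\<And>j. cmod (z $ j) = 1" and N: "norm (z - m *s zs) \<le> 4 * \<sigma>"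
    and d: "\<And>j. cmod (z $ j - m * zs $ j) \<le> \<delta>"
    using near by (auto simp: near_def \<delta>_def)
  have "(norm z)\<^sup>2 = n" using z by (simp add: norm_vec_sqr n)
  then have "2 * (m \<bullet> herm_inner zs z) = 2 * n - (norm (z - m *s zs))\<^sup>2"
    using norm_diff_sqr[OF m, of z] by simp
  moreover have "(norm (z - m *s zs))\<^sup>2 \<le> (sqrt n / 12)\<^sup>2"
    using N \<sigma> by (intro power_mono) auto
  \<comment> \<open>On the torus the correlation in direction m is n minus half the squared
    distance.\<close>
  ultimately have mh: "287 / 288 * n \<le> m \<bullet> herm_inner zs z"
    using sqrt_n_sqr by (simp add: power_divide)
  have "R \<le> m \<bullet> u"
  proof -
    have "m \<bullet> m = 1" using m by (simp flip: norm_eq_1)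
    moreover have "m \<bullet> (of_real (\<alpha> / n) * herm_inner zs z) = \<alpha> / n * (m \<bullet> herm_inner zs z)"
      by (simp add: inner_complex_def algebra_simps add_divide_distrib)
    moreover have "\<alpha> / n * (287 / 288 * n) \<le> \<alpha> / n * (m \<bullet> herm_inner zs z)"
      using mh \<alpha> n_pos by (intro mult_left_mono) auto
    ultimately show ?thesis using n_pos by (simp add: u_def R_def inner_add)
  qed
  also have "m \<bullet> u \<le> cmod u" using norm_cauchy_schwarz[of m u] m by simp
  finally have R: "R \<le> cmod u" .
  have R0: "0 < R" using \<alpha> by (simp add: R_def)
  have u0: "u \<noteq> 0" using R R0 by auto
  have wu: "w - u *s zs = (z - m *s zs) + (\<alpha> / n) *\<^sub>R (D *v z)"
    by (simp add: w_def u_def vec_eq_iff scaleR_conv_of_real[where 'a = complex] algebra_simps)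
  have wj: "cmod (w $ j - u * zs $ j) \<le> \<delta> + \<alpha> * \<eta>" for j
  proof -
    have "w $ j - u * zs $ j = (z $ j - m * zs $ j) + (\<alpha> / n) *\<^sub>R (D *v z) $ j"
      using wu by (simp add: vec_eq_iff)
    also have "cmod \<dots> \<le> \<delta> + \<alpha> / n * cmod ((D *v z) $ j)"
      using norm_triangle_ineq[of "z $ j - m * zs $ j" "(\<alpha> / n) *\<^sub>R (D *v z) $ j"] d[of j] \<alpha> n_pos by simp
    also have "cmod ((D *v z) $ j) \<le> 3 * \<sigma> * sqrt (n * ln n) + 3 * \<sigma> * sqrt n * norm (z - m *s zs)"
      by (rule D_coord_le[OF m])
    also have "\<dots> \<le> 3 * \<sigma> * sqrt (n * ln n) + 3 * \<sigma> * sqrt n * (4 * \<sigma>)"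
      using N \<sigma> n_pos by (intro add_left_mono mult_left_mono) auto
    also have "\<dots> = n * \<eta>"
      by (rule n_eta[symmetric])
    finally show ?thesis using \<alpha> n_pos by (simp add: mult_left_mono divide_right_mono)
  qed
  have close: "cmod (w $ j - u * zs $ j) \<le> 4 / 5 * cmod u" for j
  proof -
    have "4 / 5 * R \<le> 4 / 5 * cmod u" using R by simp
    then show ?thesis using wj[of j] step_constants(1)[OF T2 \<delta>_def] by (simp add: R_def)
  qed
  have z'w: "z' $ j = sgn (w $ j)" for j by (simp add: z' w_def)
  note nsd = norm_sgn_diff_le[OF u0 close]
  have "near z' (sgn u)"
    unfolding near_def
  proof (intro conjI allI)
    show "cmod (sgn u) = 1" using u0 by (simp add: norm_sgn)
    show "cmod (z' $ j) = 1" for j using nsd(2)[of j] by (simp add: z'w norm_sgn)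
    have "norm (z' - sgn u *s zs) \<le> 11181 / 10000 * (norm (w - u *s zs) / cmod u)"
      by (rule nsd(3)) (rule z'w)
    also have "norm (w - u *s zs) \<le> \<sigma> * (4 + 13 / 4 * \<alpha>)"
    proof -
      have "norm z = sqrt n" using \<open>(norm z)\<^sup>2 = n\<close> by (metis norm_ge_zero real_sqrt_unique)
      then have "norm (D *v z) \<le> 3 * \<sigma> * n"
        using D_norm[of z] sqrt_n_sqr by (simp add: mult.assoc)
      then have "\<alpha> / n * norm (D *v z) \<le> \<alpha> / n * (3 * \<sigma> * n)"
        using \<alpha> n_pos by (intro mult_left_mono) auto
      then have "\<alpha> / n * norm (D *v z) \<le> 3 * \<sigma> * \<alpha>" using n_pos by (simp add: mult_ac)
      moreover have "norm (w - u *s zs) \<le> norm (z - m *s zs) + \<alpha> / n * norm (D *v z)"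
        unfolding wu using norm_triangle_ineq[of "z - m *s zs" "(\<alpha> / n) *\<^sub>R (D *v z)"] \<alpha> n_pos by simp
      ultimately have "norm (w - u *s zs) \<le> 4 * \<sigma> + 3 * \<sigma> * \<alpha>" using N by linarith
      also have "\<dots> \<le> \<sigma> * (4 + 13 / 4 * \<alpha>)"
        using \<sigma> \<alpha> by (simp add: algebra_simps)
      finally show ?thesis .
    qed
    also have "11181 / 10000 * (\<sigma> * (4 + 13 / 4 * \<alpha>) / cmod u) \<le> 11181 / 10000 * (\<sigma> * (4 + 13 / 4 * \<alpha>) / R)"
      using R R0 \<sigma> \<alpha> by (intro mult_left_mono divide_left_mono mult_pos_pos) auto
    also have "\<dots> = \<sigma> * (11181 / 10000 * (4 + 13 / 4 * \<alpha>)) / R" by simp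
    also have "\<dots> \<le> \<sigma> * (4 * R) / R"
      using R0 \<sigma> \<alpha> by (intro divide_right_mono mult_left_mono) (auto simp: R_def)
    also have "\<dots> = 4 * \<sigma>" using R0 by simp
    finally show "norm (z' - sgn u *s zs) \<le> 4 * \<sigma>"
      by (simp add: divide_right_mono mult_left_mono)
    show "cmod (z' $ j - sgn u * zs $ j) \<le> min T 1" for j
    proof -
      have "cmod (z' $ j - sgn u * zs $ j) \<le> 11181 / 10000 * (cmod (w $ j - u * zs $ j) / cmod u)"
        unfolding z'w by (rule nsd(1))
      also have "\<dots> \<le> 11181 / 10000 * ((\<delta> + \<alpha> * \<eta>) / R)"
        using R R0 wj[of j] order_trans[OF norm_ge_zero wj[of j]] by (intro mult_left_mono frac_le) auto
      also have "\<dots> \<le> \<delta>"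
        using step_constants(2)[OF T2 \<delta>_def, folded R_def]
        by (simp only: times_divide_eq_right pos_divide_le_eq[OF R0])
      finally show ?thesis by (simp add: \<delta>_def)
    qed
  qed
  then show ?thesis by blast
qed

lemma near_estimator:
  assumes T2: "T < 2" and est: "eigenvector_estimator C z0"
  shows "\<exists>m. near z0 m"
proof -
  obtain c w where c: "cmod c = 1" and z0: "\<And>j. cmod (z0 $ j) = 1"
    and sg: "\<And>j. w $ j \<noteq> 0 \<Longrightarrow> z0 $ j = c * sgn (w $ j)"
    and w2: "norm (w - zs) \<le> 45 / 14 * \<sigma>" and w: "\<And>j. cmod (w $ j - zs $ j) \<le> \<eta>"
    using eigenvector_estimator_close[OF est] by metis
  have close: "cmod (w $ j - 1 * zs $ j) \<le> 4 / 5 * cmod 1" for j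
    using w[of j] eta_le[OF T2] by simp
  have one: "(1 :: complex) \<noteq> 0" by simp
  note nsd = norm_sgn_diff_le[OF one close]
  have z0w: "z0 $ j = c * sgn (w $ j)" for j using sg[OF nsd(2)] .
  have "11181 / 10000 * \<eta> \<le> min T 1"
  proof -
    have T0: "0 \<le> T"
      using eta_le_T mult_nonneg_nonneg[OF _ eta_nonneg, of \<alpha>] \<alpha>
      by (smt (verit) mult_pos_neg divide_pos_pos)
    have "\<alpha> * (11181 / 10000 * \<eta>) \<le> 11181 / 10000 * ((7 * \<alpha> + 8) / 16 * T)"
      using mult_left_mono[OF eta_le_T, of "11181 / 10000"] by (simp only: mult_ac)
    also have "\<dots> = T * (11181 / 10000 * ((7 * \<alpha> + 8) / 16))" by simp
    also have "\<dots> \<le> T * \<alpha>" using T0 \<alpha> by (intro mult_left_mono) auto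
    finally have "11181 / 10000 * \<eta> \<le> T" using \<alpha> by (simp add: mult.commute[of T])
    then show ?thesis using eta_le[OF T2] by simp
  qed
  note e = this
  have "near z0 c"
    unfolding near_def
  proof (intro conjI allI)
    show "cmod (z0 $ j - c * zs $ j) \<le> min T 1" for j
    proof -
      have "cmod (z0 $ j - c * zs $ j) = cmod (sgn (w $ j) - zs $ j)"
        using c by (simp add: z0w norm_mult flip: right_diff_distrib)
      also have "\<dots> \<le> 11181 / 10000 * cmod (w $ j - zs $ j)" using nsd(1)[of j] by simp
      also have "\<dots> \<le> 11181 / 10000 * \<eta>" using w[of j] by simp
      finally show ?thesis using e by linarith
    qed
    define z' where "z' = (\<chi> j. sgn (w $ j))"
    have "norm (z0 - c *s zs) = norm (z' - zs)"
      using c by (simp add: norm_vec_def L2_set_def z0w z'_def norm_mult flip: right_diff_distrib)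
    also have "\<dots> \<le> 11181 / 10000 * norm (w - zs)"
      using nsd(3)[of z'] by (simp add: z'_def)
    finally show "norm (z0 - c *s zs) \<le> 4 * \<sigma>" using w2 \<sigma> by simp
  qed (simp_all add: c z0)
  then show ?thesis by blast
qed

lemma gpm_dist_infty_le:
  assumes est: "eigenvector_estimator C z0"
  shows "phase_dist \<infinity> (gpm C \<alpha> z0 k) zs \<le> T"
proof (cases "T < 2")
  case True
  have "\<exists>m. near (gpm C \<alpha> z0 k) m"
  proof (induction k)
    case 0
    then show ?case using near_estimator[OF True est] by simp
  next
    case (Suc k)
    then show ?case using near_step[OF True] gpm_Suc by blast
  qed
  then obtain m where "near (gpm C \<alpha> z0 k) m" by blast
  then show ?thesis by (intro phase_dist_infty_le[of m]) (auto simp: near_def)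
next
  case False
  have z0: "\<And>j. cmod (z0 $ j) = 1" using eigenvector_estimator_close[OF est] by metis
  have "cmod (gpm C \<alpha> z0 k $ j - 1 * zs $ j) \<le> T" for j
    using norm_triangle_ineq4[of "gpm C \<alpha> z0 k $ j" "zs $ j"] gpm_cmod_le[OF z0, of k j] zs[of j] False
    by simp
  then show ?thesis by (intro phase_dist_infty_le[of 1]) auto
qed

end

section \<open>Randomised rounding\<close>

text \<open>The law of independent coins with success probabilities p, as a finite weight:
  expectations become finite sums.\<close>

definition bernoulli_weight :: "('i::finite \<Rightarrow> real) \<Rightarrow> ('i \<Rightarrow> bool) \<Rightarrow> real" where
  "bernoulli_weight p e = (\<Prod>a\<in>UNIV. if e a then p a else 1 - p a)"

definition bernoulli_mean :: "('i::finite \<Rightarrow> real) \<Rightarrow> (('i \<Rightarrow> bool) \<Rightarrow> real) \<Rightarrow> real" where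
  "bernoulli_mean p f = (\<Sum>e\<in>UNIV. bernoulli_weight p e * f e)"

lemma prod_sum_UNIV:
  fixes g :: "'i::finite \<Rightarrow> 'b::finite \<Rightarrow> real"
  shows "(\<Prod>a\<in>UNIV. \<Sum>b\<in>UNIV. g a b) = (\<Sum>e\<in>UNIV. \<Prod>a\<in>UNIV. g a (e a))"
  using prod_sum_PiE[of "UNIV :: 'i set" "\<lambda>_. UNIV :: 'b set" g] by simp

lemma bernoulli_mean_prod:
  "bernoulli_mean p (\<lambda>e. \<Prod>a\<in>UNIV. g a (e a)) = (\<Prod>a\<in>UNIV. p a * g a True + (1 - p a) * g a False)"
proof -
  have "bernoulli_mean p (\<lambda>e. \<Prod>a\<in>UNIV. g a (e a))
      = (\<Sum>e\<in>UNIV. \<Prod>a\<in>UNIV. (if e a then p a else 1 - p a) * g a (e a))"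
    by (simp add: bernoulli_mean_def bernoulli_weight_def prod.distrib)
  also have "\<dots> = (\<Prod>a\<in>UNIV. \<Sum>b\<in>UNIV. (if b then p a else 1 - p a) * g a b)"
    by (rule prod_sum_UNIV[symmetric])
  also have "\<dots> = (\<Prod>a\<in>UNIV. p a * g a True + (1 - p a) * g a False)"
    by (simp add: UNIV_bool add.commute)
  finally show ?thesis .
qed

lemma bernoulli_mean_single:
  "bernoulli_mean p (\<lambda>e. f (e a)) = p a * f True + (1 - p a) * f False"
proof -
  have "bernoulli_mean p (\<lambda>e. f (e a)) = bernoulli_mean p (\<lambda>e. \<Prod>c\<in>UNIV. if c = a then f (e c) else 1)"
    by (simp add: prod.delta)
  also have "\<dots> = (\<Prod>c\<in>UNIV. p c * (if c = a then f True else 1) + (1 - p c) * (if c = a then f False else 1))"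
    by (rule bernoulli_mean_prod)
  also have "\<dots> = (\<Prod>c\<in>UNIV. if c = a then p c * f True + (1 - p c) * f False else 1)"
    by (intro prod.cong) auto
  also have "\<dots> = p a * f True + (1 - p a) * f False" by (simp add: prod.delta)
  finally show ?thesis .
qed

lemma bernoulli_mean_pair:
  assumes "a \<noteq> b"
  shows "bernoulli_mean p (\<lambda>e. f (e a) * g (e b)) =
    (p a * f True + (1 - p a) * f False) * (p b * g True + (1 - p b) * g False)"
proof -
  define h where "h c x = (if c = a then f x else if c = b then g x else 1)" for c x
  have split: "(\<Prod>c\<in>UNIV. k c) = k a * k b" if "\<And>c. c \<noteq> a \<Longrightarrow> c \<noteq> b \<Longrightarrow> k c = 1" for k :: "'a \<Rightarrow> real"
  proof -
    have "(\<Prod>c\<in>UNIV. k c) = (\<Prod>c\<in>{a, b}. k c)"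
      using that by (intro prod.mono_neutral_right) auto
    then show ?thesis using assms by simp
  qed
  have "bernoulli_mean p (\<lambda>e. f (e a) * g (e b)) = bernoulli_mean p (\<lambda>e. \<Prod>c\<in>UNIV. h c (e c))"
    by (subst split) (use assms in \<open>auto simp: h_def\<close>)
  also have "\<dots> = (\<Prod>c\<in>UNIV. p c * h c True + (1 - p c) * h c False)"
    by (rule bernoulli_mean_prod)
  also have "\<dots> = (p a * f True + (1 - p a) * f False) * (p b * g True + (1 - p b) * g False)"
    by (subst split) (use assms in \<open>auto simp: h_def\<close>)
  finally show ?thesis .
qed

lemma bernoulli_mean_const: "bernoulli_mean p (\<lambda>_. c) = c"
  using bernoulli_mean_single[of p "\<lambda>_. c"] by (simp add: algebra_simps)

lemma bernoulli_mean_linear: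
  "bernoulli_mean p (\<lambda>e. f e + g e) = bernoulli_mean p f + bernoulli_mean p g"
  "bernoulli_mean p (\<lambda>e. f e - g e) = bernoulli_mean p f - bernoulli_mean p g"
  "bernoulli_mean p (\<lambda>e. c * f e) = c * bernoulli_mean p f"
  "bernoulli_mean p (\<lambda>e. \<Sum>x\<in>X. h x e) = (\<Sum>x\<in>X. bernoulli_mean p (h x))"
  by (simp_all add: bernoulli_mean_def algebra_simps sum.distrib sum_subtractf sum_distrib_left)
    (subst sum.swap, simp)

lemma bernoulli_weight_nonneg: "(\<And>a. 0 \<le> p a \<and> p a \<le> 1) \<Longrightarrow> 0 \<le> bernoulli_weight p e"
  unfolding bernoulli_weight_def by (intro prod_nonneg) auto

lemma bernoulli_mean_mono:
  assumes "\<And>a. 0 \<le> p a \<and> p a \<le> 1" "\<And>e. f e \<le> g e"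
  shows "bernoulli_mean p f \<le> bernoulli_mean p g"
  unfolding bernoulli_mean_def using assms by (intro sum_mono mult_left_mono bernoulli_weight_nonneg) auto

text \<open>Jensen's inequality from the tangent line to exp at the mean.\<close>

lemma exp_bernoulli_mean_le:
  assumes "\<And>a. 0 \<le> p a \<and> p a \<le> 1"
  shows "exp (bernoulli_mean p f) \<le> bernoulli_mean p (\<lambda>e. exp (f e))"
proof -
  define m where "m = bernoulli_mean p f"
  have "exp m * (1 + (f e - m)) \<le> exp (f e)" for e
  proof -
    have "exp m * (1 + (f e - m)) \<le> exp m * exp (f e - m)"
      by (intro mult_left_mono exp_ge_add_one_self) auto
    then show ?thesis by (simp flip: exp_add)
  qed
  then have "bernoulli_mean p (\<lambda>e. exp m * (1 + (f e - m))) \<le> bernoulli_mean p (\<lambda>e. exp (f e))"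
    by (intro bernoulli_mean_mono assms)
  also have "bernoulli_mean p (\<lambda>e. exp m * (1 + (f e - m))) = exp m"
    by (simp add: bernoulli_mean_linear bernoulli_mean_const m_def)
  finally show ?thesis by (simp add: m_def)
qed

text \<open>Apply ln x \<le> x - 1 to both logarithms: the entropy of a coin is at least twice its
  variance.\<close>

lemma entropy_ge:
  fixes f :: real
  assumes "0 \<le> f" "f \<le> 1"
  shows "f * ln f + (1 - f) * ln (1 - f) \<le> - 2 * (f * (1 - f))"
proof -
  have *: "x * ln x \<le> x * (x - 1)" if "0 \<le> x" for x :: real
    using that ln_le_minus_one[of x] by (cases "x = 0") (auto intro!: mult_left_mono)
  show ?thesis using *[of f] *[of "1 - f"] assms by (simp add: algebra_simps)
qed

text \<open>A discrete Gaussian, (3/4)^(x^2) over an upper bound for its sum on the integers. The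
  rate ln (4/3) is close to 1/4, the rate of a Gaussian of variance 2, and a vector of squared norm
  4n has mean square 2 over its 2n real coordinates.\<close>

definition prior :: "real \<Rightarrow> real" where
  "prior x = exp (- ln (4 / 3) * x\<^sup>2) / (18 / 5)"

definition rounding :: "('i \<Rightarrow> real) \<Rightarrow> ('i \<Rightarrow> bool) \<Rightarrow> 'i \<Rightarrow> int" where
  "rounding t e a = \<lfloor>t a\<rfloor> + of_bool (e a)"

text \<open>
  Jensen's inequality for randomised rounding of \<open>t\<close>: the mean of a quadratic form without
  diagonal terms is its value at \<open>t\<close>, and the entropy of the rounding pays for the variance.
\<close>

lemma rounding_lower_bound:
  fixes t :: "'i::finite \<Rightarrow> real" and A :: "'i \<Rightarrow> 'i \<Rightarrow> real"
  assumes diag: "\<And>a. A a a = 0" and lam: "0 \<le> lam"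
  defines "Q \<equiv> \<lambda>k. \<Sum>a\<in>UNIV. \<Sum>b\<in>UNIV. A a b * k a * k b"
    and "S \<equiv> \<lambda>k. \<Sum>a\<in>UNIV. (k a)\<^sup>2"
    and "V \<equiv> \<Sum>a\<in>UNIV. frac (t a) * (1 - frac (t a))"
  shows "exp (\<theta> * Q t - lam * ((S t + V)\<^sup>2 + 2 * (S t + V)) - ln (4 / 3) * (S t + V)
      - real CARD('i) * ln (18 / 5) + 2 * V)
    \<le> (\<Sum>e\<in>UNIV. (\<Prod>a\<in>UNIV. prior (rounding t e a)) *
        exp (\<theta> * Q (\<lambda>a. rounding t e a) - lam * (S (\<lambda>a. rounding t e a))\<^sup>2))"
proof -
  define p where "p a = frac (t a)" for a
  have p: "0 \<le> p a \<and> p a \<le> 1" for a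
    using frac_ge_0[of "t a"] frac_lt_1[of "t a"] by (simp add: p_def)
  define x where "x a b = real_of_int \<lfloor>t a\<rfloor> + of_bool b" for a and b :: bool
  have x: "real_of_int (rounding t e a) = x a (e a)" for e a
    by (simp add: rounding_def x_def)
  have t: "t a = of_int \<lfloor>t a\<rfloor> + p a" for a by (simp add: p_def frac_def)
  define v where "v a = p a * (1 - p a)" for a
  have v: "0 \<le> v a" "v a \<le> 1 / 4" for a
  proof -
    show "0 \<le> v a" using p[of a] by (simp add: v_def)
    have "v a = 1 / 4 - (p a - 1 / 2)\<^sup>2" by (simp add: v_def power2_eq_square algebra_simps)
    then show "v a \<le> 1 / 4" by simp
  qed
  have mean: "p a * x a True + (1 - p a) * x a False = t a" for a
    using t[of a] by (simp add: x_def algebra_simps)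
  have mean2: "p a * (x a True)\<^sup>2 + (1 - p a) * (x a False)\<^sup>2 = (t a)\<^sup>2 + v a" for a
    unfolding x_def v_def by (subst (3) t) (simp add: power2_eq_square algebra_simps)
  \<comment> \<open>The fourth moment is the square of the second moment plus the variance of the
    square. A variable with two values has variance \<open>p a * (1 - p a)\<close> times the squared
    gap.\<close>
  have mean4: "p a * ((x a True)\<^sup>2 * (x a True)\<^sup>2) + (1 - p a) * ((x a False)\<^sup>2 * (x a False)\<^sup>2)
      \<le> ((t a)\<^sup>2 + v a)\<^sup>2 + 2 * ((t a)\<^sup>2 + v a)" for a
  proof -
    have "p a * ((x a True)\<^sup>2 * (x a True)\<^sup>2) + (1 - p a) * ((x a False)\<^sup>2 * (x a False)\<^sup>2)
        = (p a * (x a True)\<^sup>2 + (1 - p a) * (x a False)\<^sup>2)\<^sup>2 + v a * ((x a True)\<^sup>2 - (x a False)\<^sup>2)\<^sup>2"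
      by (simp add: v_def power2_eq_square algebra_simps)
    also have "(x a True)\<^sup>2 - (x a False)\<^sup>2 = 2 * t a + (1 - 2 * p a)"
      using t[of a] by (simp add: x_def power2_eq_square algebra_simps)
    also have "v a * (2 * t a + (1 - 2 * p a))\<^sup>2 \<le> v a * (8 * (t a)\<^sup>2 + 2 * (1 - 2 * p a)\<^sup>2)"
    proof (intro mult_left_mono v)
      have "0 \<le> (2 * t a - (1 - 2 * p a))\<^sup>2" by simp
      then show "(2 * t a + (1 - 2 * p a))\<^sup>2 \<le> 8 * (t a)\<^sup>2 + 2 * (1 - 2 * p a)\<^sup>2"
        by (simp add: power2_eq_square algebra_simps)
    qed
    also have "\<dots> = 8 * (t a)\<^sup>2 * v a + 2 * v a - 8 * (v a)\<^sup>2"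
      by (simp add: v_def power2_eq_square algebra_simps)
    also have "\<dots> \<le> 2 * ((t a)\<^sup>2 + v a)"
    proof -
      have "8 * (t a)\<^sup>2 * v a \<le> 8 * (t a)\<^sup>2 * (1 / 4)" by (intro mult_left_mono v) auto
      then have "8 * (t a)\<^sup>2 * v a + 2 * v a - 8 * (v a)\<^sup>2 \<le> 8 * (t a)\<^sup>2 * (1 / 4) + 2 * v a - 0"
        by (intro diff_mono add_mono) auto
      then show ?thesis by simp
    qed
    finally show ?thesis by (simp add: mean2)
  qed
  define M where "M = S t + V"
  have M: "M = (\<Sum>a\<in>UNIV. (t a)\<^sup>2 + v a)"
    by (simp add: M_def S_def V_def v_def p_def sum.distrib)
  have EQ: "bernoulli_mean p (\<lambda>e. Q (\<lambda>a. rounding t e a)) = Q t"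
  proof -
    have "bernoulli_mean p (\<lambda>e. A a b * x a (e a) * x b (e b)) = A a b * t a * t b" for a b
    proof (cases "a = b")
      case False
      have "bernoulli_mean p (\<lambda>e. A a b * (x a (e a) * x b (e b))) = A a b * (t a * t b)"
        using bernoulli_mean_pair[OF False, of p "x a" "x b"] by (simp only: bernoulli_mean_linear mean)
      then show ?thesis by (simp add: mult.assoc)
    qed (simp add: diag bernoulli_mean_const)
    then show ?thesis by (simp add: Q_def x bernoulli_mean_linear)
  qed
  have ES2: "bernoulli_mean p (\<lambda>e. (S (\<lambda>a. rounding t e a))\<^sup>2) \<le> M\<^sup>2 + 2 * M"
  proof -
    define m where "m a = (t a)\<^sup>2 + v a" for a
    have "bernoulli_mean p (\<lambda>e. (x a (e a))\<^sup>2 * (x b (e b))\<^sup>2) \<le> m a * m b + (if a = b then 2 * m a else 0)" for a b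
    proof (cases "a = b")
      case True
      then show ?thesis
        using bernoulli_mean_single[of p "\<lambda>c. (x a c)\<^sup>2 * (x a c)\<^sup>2" a] mean4[of a]
        by (simp add: m_def power2_eq_square)
    next
      case False
      then show ?thesis
        using bernoulli_mean_pair[OF False, of p "\<lambda>c. (x a c)\<^sup>2" "\<lambda>c. (x b c)\<^sup>2"] by (simp add: mean2 m_def)
    qed
    then have "(\<Sum>a\<in>UNIV. \<Sum>b\<in>UNIV. bernoulli_mean p (\<lambda>e. (x a (e a))\<^sup>2 * (x b (e b))\<^sup>2))
        \<le> (\<Sum>a\<in>UNIV. \<Sum>b\<in>UNIV. m a * m b + (if a = b then 2 * m a else 0))"
      by (intro sum_mono)
    also have "\<dots> = M\<^sup>2 + 2 * M"
    proof -
      have "M = sum m UNIV" by (simp add: M m_def)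
      then show ?thesis
        by (simp add: sum.distrib power2_eq_square sum_product flip: sum_distrib_left)
    qed
    also have "(\<Sum>a\<in>UNIV. \<Sum>b\<in>UNIV. bernoulli_mean p (\<lambda>e. (x a (e a))\<^sup>2 * (x b (e b))\<^sup>2))
        = bernoulli_mean p (\<lambda>e. (S (\<lambda>a. rounding t e a))\<^sup>2)"
      by (simp add: S_def x power2_eq_square[of "sum _ _"] sum_product bernoulli_mean_linear)
    finally show ?thesis .
  qed
  \<comment> \<open>The logarithms of the rounding law and of the prior. Adding
    \<open>lp e - lw e\<close> to the exponent changes the measure from the rounding law to the
    prior.\<close>
  define lw where "lw e = (\<Sum>a\<in>UNIV. ln (if e a then p a else 1 - p a))" for e
  define lp where "lp e = (\<Sum>a\<in>UNIV. ln (prior (x a (e a))))" for e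
  have Elw: "bernoulli_mean p lw \<le> - 2 * V"
  proof -
    have "bernoulli_mean p lw = (\<Sum>a\<in>UNIV. p a * ln (p a) + (1 - p a) * ln (1 - p a))"
      unfolding lw_def bernoulli_mean_linear
      by (subst bernoulli_mean_single[of p "\<lambda>c. ln (if c then p _ else 1 - p _)"]) simp
    also have "\<dots> \<le> (\<Sum>a\<in>UNIV. - 2 * v a)"
      unfolding v_def using p by (intro sum_mono entropy_ge) auto
    also have "\<dots> = - 2 * V" by (simp add: V_def v_def p_def sum_distrib_left sum_negf)
    finally show ?thesis .
  qed
  have Elp: "bernoulli_mean p lp = - ln (4 / 3) * M - real CARD('i) * ln (18 / 5)"
  proof -
    have lnp: "ln (prior y) = - ln (4 / 3) * y\<^sup>2 - ln (18 / 5)" for y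
      unfolding prior_def by (subst ln_divide_pos) auto
    have "bernoulli_mean p (\<lambda>e. ln (prior (x a (e a)))) = - ln (4 / 3) * ((t a)\<^sup>2 + v a) - ln (18 / 5)" for a
    proof -
      have "bernoulli_mean p (\<lambda>e. ln (prior (x a (e a)))) =
          p a * (- ln (4 / 3) * (x a True)\<^sup>2 - ln (18 / 5)) + (1 - p a) * (- ln (4 / 3) * (x a False)\<^sup>2 - ln (18 / 5))"
        using bernoulli_mean_single[of p "\<lambda>c. ln (prior (x a c))" a] by (simp only: lnp)
      also have "\<dots> = - ln (4 / 3) * (p a * (x a True)\<^sup>2 + (1 - p a) * (x a False)\<^sup>2) - ln (18 / 5)"
        by (simp only: algebra_simps)
      finally show ?thesis by (simp only: mean2)
    qed
    then have "bernoulli_mean p lp = (\<Sum>a\<in>UNIV. - ln (4 / 3) * ((t a)\<^sup>2 + v a) - ln (18 / 5))"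
      unfolding lp_def bernoulli_mean_linear by (intro sum.cong refl)
    then show ?thesis by (simp only: sum_subtractf M sum_distrib_left) simp
  qed
  define f where "f e = \<theta> * Q (\<lambda>a. rounding t e a) - lam * (S (\<lambda>a. rounding t e a))\<^sup>2" for e
  have "\<theta> * Q t - lam * (M\<^sup>2 + 2 * M) - ln (4 / 3) * M - real CARD('i) * ln (18 / 5) + 2 * V
      \<le> bernoulli_mean p (\<lambda>e. f e + lp e - lw e)"
    unfolding f_def using Elw mult_left_mono[OF ES2 lam]
    by (simp only: bernoulli_mean_linear EQ Elp)
  then have "exp (\<theta> * Q t - lam * (M\<^sup>2 + 2 * M) - ln (4 / 3) * M - real CARD('i) * ln (18 / 5) + 2 * V)
      \<le> bernoulli_mean p (\<lambda>e. exp (f e + lp e - lw e))"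
    using exp_bernoulli_mean_le[of p "\<lambda>e. f e + lp e - lw e"] p
    by (meson exp_le_cancel_iff order_trans)
  also have "\<dots> \<le> (\<Sum>e\<in>UNIV. (\<Prod>a\<in>UNIV. prior (rounding t e a)) * exp (f e))"
    unfolding bernoulli_mean_def
  proof (intro sum_mono)
    fix e :: "'i \<Rightarrow> bool"
    define q where "q a = (if e a then p a else 1 - p a)" for a
    have q0: "0 \<le> q a" for a using p[of a] by (simp add: q_def)
    have "exp (lp e) = (\<Prod>a\<in>UNIV. prior (rounding t e a))"
      by (simp add: lp_def exp_sum x prior_def)
    moreover have "exp (- lw e) = (\<Prod>a\<in>UNIV. exp (- ln (q a)))"
      by (simp add: lw_def q_def exp_sum flip: sum_negf)
    \<comment> \<open>Equality fails only for patterns of probability 0. With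
      \<open>ln 0 = 0\<close> such a factor contributes 0 times 1.\<close>
    moreover have "bernoulli_weight p e * (\<Prod>a\<in>UNIV. exp (- ln (q a))) \<le> 1"
    proof -
      have "q a * exp (- ln (q a)) \<le> 1" for a
        using q0[of a] by (cases "q a = 0") (auto simp: exp_minus)
      then have "(\<Prod>a\<in>UNIV. q a * exp (- ln (q a))) \<le> 1"
        using q0 by (intro prod_le_1) auto
      then show ?thesis by (simp add: bernoulli_weight_def q_def prod.distrib)
    qed
    moreover have "exp (f e + lp e - lw e) = exp (f e) * exp (lp e) * exp (- lw e)"
      by (simp add: exp_diff exp_add exp_minus divide_inverse)
    ultimately have eq: "bernoulli_weight p e * exp (f e + lp e - lw e)
        = (bernoulli_weight p e * (\<Prod>a\<in>UNIV. exp (- ln (q a)))) * ((\<Prod>a\<in>UNIV. prior (rounding t e a)) * exp (f e))"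
      by (simp only: mult_ac)
    show "bernoulli_weight p e * exp (f e + lp e - lw e) \<le> (\<Prod>a\<in>UNIV. prior (rounding t e a)) * exp (f e)"
      unfolding eq using \<open>bernoulli_weight p e * (\<Prod>a\<in>UNIV. exp (- ln (q a))) \<le> 1\<close>
      by (intro mult_left_le_one_le mult_nonneg_nonneg bernoulli_weight_nonneg p prod_nonneg)
        (auto simp: prior_def)
  qed
  finally show ?thesis unfolding M_def f_def .
qed

text \<open>From (k - 1)(k - 2) \<ge> 0 follows k^2 \<ge> 1 + 3 (k - 1), which compares the sum with
  a geometric series of ratio (3/4)^3 = 27/64. The total 1 + 96/37 is just below 18/5.\<close>

lemma sum_prior_le_1: "(\<Sum>k\<in>{- int K..int K}. prior (of_int k)) \<le> 1"
proof -
  define g where "g k = exp (- ln (4 / 3) * (real k)\<^sup>2)" for k :: nat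
  have g: "g k \<le> 3 / 4 * (27 / 64) ^ (k - 1)" if "1 \<le> k" for k
  proof -
    have "0 \<le> (real k - 1) * (real k - 2)"
    proof (cases "k = 1")
      case False
      with that have "2 \<le> k" by simp
      then show ?thesis by (intro mult_nonneg_nonneg) auto
    qed simp
    then have "1 + 3 * real (k - 1) \<le> (real k)\<^sup>2"
      using that by (simp add: of_nat_diff power2_eq_square algebra_simps)
    then have "- ln (4 / 3) * (real k)\<^sup>2 \<le> - ln (4 / 3) * (1 + 3 * real (k - 1))"
      by (simp add: mult_left_mono)
    then have "g k \<le> exp (- ln (4 / 3) * (1 + 3 * real (k - 1)))" by (simp add: g_def)
    also have "\<dots> = exp (- ln (4 / 3)) * exp (- ln (4 / 3)) ^ (3 * (k - 1))"
      unfolding exp_of_nat_mult[symmetric] exp_add[symmetric] by (simp add: distrib_left)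
    also have "exp (- ln (4 / 3)) = (3 / 4 :: real)" by (simp add: exp_minus)
    also have "(3 / 4 :: real) ^ (3 * (k - 1)) = (27 / 64) ^ (k - 1)"
      by (simp add: power_mult power3_eq_cube)
    finally show ?thesis .
  qed
  have "(\<Sum>k\<in>{- int K..int K}. exp (- ln (4 / 3) * (real_of_int k)\<^sup>2)) = 1 + 2 * (\<Sum>k=1..K. g k)"
  proof (induction K)
    case 0
    show ?case by simp
  next
    case (Suc K)
    have "{- int (Suc K)..int (Suc K)} = insert (int (Suc K)) (insert (- int (Suc K)) {- int K..int K})"
      by auto
    moreover have "(- 1 - real K)\<^sup>2 = (1 + real K)\<^sup>2"
      by (simp add: power2_eq_square algebra_simps)
    ultimately show ?case using Suc by (simp add: g_def)
  qed
  also have "(\<Sum>k=1..K. g k) \<le> (\<Sum>k=1..K. 3 / 4 * (27 / 64) ^ (k - 1))"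
    by (intro sum_mono g) auto
  also have "\<dots> = 3 / 4 * (\<Sum>k<K. (27 / 64) ^ k)"
    unfolding sum_distrib_left by (rule sum.reindex_bij_witness[of _ Suc "\<lambda>k. k - 1"]) auto
  also have "(\<Sum>k<K. (27 / 64) ^ k) \<le> (64 / 37 :: real)"
  proof -
    have "(\<Sum>k<K. (27 / 64) ^ k) = (1 - (27 / 64) ^ K) * (64 / 37 :: real)"
      by (subst geometric_sum) (simp_all add: field_simps)
    then show ?thesis by simp
  qed
  finally have "(\<Sum>k\<in>{- int K..int K}. exp (- ln (4 / 3) * (real_of_int k)\<^sup>2)) \<le> 18 / 5" by simp
  then show ?thesis unfolding prior_def sum_divide_distrib[symmetric] by simp
qed

lemma ln_bounds: "ln (4 / 3 :: real) \<le> 3 / 10" "ln (18 / 5 :: real) \<le> 129 / 100"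
proof -
  have "(4 / 3 :: real) \<le> exp (3 / 10)"
    using exp_lower_Taylor_quadratic[of "3 / 10 :: real"] by (simp add: power2_eq_square)
  then have "ln (4 / 3 :: real) \<le> ln (exp (3 / 10))" by (subst ln_le_cancel_iff) auto
  then show "ln (4 / 3 :: real) \<le> 3 / 10" by simp
  have "ln (18 / 5 :: real) = ln (2 * (2 * (9 / 10)))" by simp
  also have "\<dots> = 2 * ln 2 + ln (9 / 10)" by (simp only: ln_mult_pos)
  finally show "ln (18 / 5 :: real) \<le> 129 / 100"
    using ln2_le_25_over_36 ln_le_minus_one[of "9 / 10 :: real"] by simp
qed

section \<open>Quadratic forms on the grid\<close>

definition cvec :: "('n \<times> bool \<Rightarrow> real) \<Rightarrow> complex ^ 'n" where
  "cvec k = (\<chi> i. Complex (k (i, False)) (k (i, True)))"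

lemma sum_UNIV_prod_bool:
  "(\<Sum>a\<in>(UNIV :: ('n::finite \<times> bool) set). f a) = (\<Sum>i\<in>UNIV. f (i, False) + f (i, True))"
  for f :: "_ \<Rightarrow> 'a::comm_monoid_add"
proof -
  have "(\<Sum>a\<in>UNIV. f a) = (\<Sum>i\<in>UNIV. \<Sum>s\<in>UNIV. f (i, s))"
    by (simp add: sum.cartesian_product flip: UNIV_Times_UNIV)
  then show ?thesis by (simp add: UNIV_bool)
qed

text \<open>The matrix of the form in the 2n real coordinates. Its diagonal vanishes along with that
  of A, as \<open>rounding_lower_bound\<close> requires.\<close>

definition real_entry :: "complex ^ 'n ^ 'n \<Rightarrow> 'n \<times> bool \<Rightarrow> 'n \<times> bool \<Rightarrow> real" where
  "real_entry A a b = (if snd a then \<i> else 1) \<bullet> (A $ fst a $ fst b * (if snd b then \<i> else 1))"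

lemma cvec_quadratic_form:
  "cvec k \<bullet> (A *v cvec k) = (\<Sum>a\<in>UNIV. \<Sum>b\<in>UNIV. real_entry A a b * k a * k b)"
proof -
  have "cvec k \<bullet> (A *v cvec k) = (\<Sum>i\<in>UNIV. \<Sum>j\<in>UNIV. cvec k $ i \<bullet> (A $ i $ j * cvec k $ j))"
    by (simp add: inner_vec_def matrix_vector_mult_def inner_sum_right)
  also have "\<dots> = (\<Sum>i\<in>UNIV. \<Sum>j\<in>UNIV.
      real_entry A (i, False) (j, False) * k (i, False) * k (j, False) +
      real_entry A (i, False) (j, True) * k (i, False) * k (j, True) +
      (real_entry A (i, True) (j, False) * k (i, True) * k (j, False) +
      real_entry A (i, True) (j, True) * k (i, True) * k (j, True)))"
    by (intro sum.cong refl) (simp add: cvec_def real_entry_def inner_complex_def algebra_simps)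
  also have "\<dots> = (\<Sum>a\<in>UNIV. \<Sum>b\<in>UNIV. real_entry A a b * k a * k b)"
    by (simp only: sum_UNIV_prod_bool sum.distrib)
  finally show ?thesis .
qed

lemma cvec_norm: "(norm (cvec k))\<^sup>2 = (\<Sum>a\<in>UNIV. (k a)\<^sup>2)"
  by (simp only: norm_vec_sqr sum_UNIV_prod_bool) (simp add: cvec_def cmod_power2)

text \<open>The radius is generous at no cost: the prior has mass at most 1 for any radius, and
  finiteness keeps the average a finite sum.\<close>

definition grid :: "('i::finite \<Rightarrow> int) set" where
  "grid = PiE UNIV (\<lambda>_. {- int (2 * CARD('i) + 1)..int (2 * CARD('i) + 1)})"

definition grid_weight :: "('i::finite \<Rightarrow> int) \<Rightarrow> real" where
  "grid_weight k = (\<Prod>a\<in>UNIV. prior (of_int (k a)))"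

lemma finite_grid: "finite grid"
  unfolding grid_def by (intro finite_PiE) auto

lemma grid_weight_nonneg: "0 \<le> grid_weight k"
  unfolding grid_weight_def by (intro prod_nonneg) (simp add: prior_def)

lemma sum_grid_weight_le: "(\<Sum>k\<in>grid. grid_weight (k :: 'i::finite \<Rightarrow> int)) \<le> 1"
proof -
  have "(\<Sum>k\<in>grid. grid_weight (k :: 'i \<Rightarrow> int)) =
      (\<Prod>a\<in>(UNIV :: 'i set). \<Sum>x\<in>{- int (2 * CARD('i) + 1)..int (2 * CARD('i) + 1)}. prior (of_int x))"
    unfolding grid_def grid_weight_def
    by (rule prod_sum_PiE[symmetric]) auto
  also have "\<dots> \<le> 1"
    using sum_prior_le_1[of "2 * CARD('i) + 1"] by (intro prod_le_1 conjI sum_nonneg) (auto simp: prior_def)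
  finally show ?thesis .
qed

text \<open>
  The first argument is the sign of the quadratic form. The grid contains all roundings of
  vectors of norm \<open>2 * sqrt n\<close>.
\<close>

definition mgf_sum :: "real \<Rightarrow> complex ^ 'n::finite ^ 'n \<Rightarrow> real" where
  "mgf_sum s A = (\<Sum>k\<in>grid. grid_weight k *
    exp (s * (5 / (8 * sqrt CARD('n))) * (cvec (\<lambda>a. of_int (k a)) \<bullet> (A *v cvec (\<lambda>a. of_int (k a))))
      - 25 / (128 * real CARD('n)) * (1 - 1 / CARD('n)) * ((norm (cvec (\<lambda>a. of_int (k a))))\<^sup>2)\<^sup>2))"

text \<open>Per unit of n the balance at V = 0 is 15/2 - 25/8 - 6/5 - 129/50 = 0.595, and the
  coefficient of V, 2 - 425/256 - 3/10, is positive. An exponent c / sqrt n would contribute 12 c -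
  8 c^2, which is largest at c = 3/4; the choice 5/8 loses only 1/8 and lets the entropy term 2V pay
  for all losses in V. The factor 1 - 1/n absorbs the term 2M of the second moment, because M \<ge>
  2n.\<close>

lemma rounding_numerics:
  fixes n V L1 L2 :: real
  assumes n: "1 \<le> n" and V: "0 \<le> V" "V \<le> n / 2" and L: "L1 \<le> 3 / 10" "L2 \<le> 129 / 100"
  shows "n / 2 \<le> 15 / 2 * n - 25 / (128 * n) * (1 - 1 / n) * ((4 * n + V)\<^sup>2 + 2 * (4 * n + V))
    - L1 * (4 * n + V) - 2 * n * L2 + 2 * V"
proof -
  define M where "M = 4 * n + V"
  have M: "4 * n \<le> M" using V by (simp add: M_def)
  have "(1 - 1 / n) * (M\<^sup>2 + 2 * M) \<le> M\<^sup>2"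
  proof -
    have "2 * n * M \<le> M * M" using M n by (intro mult_right_mono) auto
    moreover have "(n - 1) * (M\<^sup>2 + 2 * M) = n * M\<^sup>2 - (M * M - 2 * n * M) - 2 * M"
      by (simp add: power2_eq_square algebra_simps)
    ultimately have "(n - 1) * (M\<^sup>2 + 2 * M) \<le> n * M\<^sup>2"
      using M n by linarith
    then have "(n - 1) * (M\<^sup>2 + 2 * M) / n \<le> M\<^sup>2" using n by (simp add: pos_divide_le_eq mult.commute)
    moreover have "(n - 1) * (M\<^sup>2 + 2 * M) / n = (1 - 1 / n) * (M\<^sup>2 + 2 * M)"
      using n by (simp add: field_simps)
    ultimately show ?thesis by simp
  qed
  then have "25 / (128 * n) * ((1 - 1 / n) * (M\<^sup>2 + 2 * M)) \<le> 25 / (128 * n) * M\<^sup>2"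
    using n by (intro mult_left_mono) auto
  also have "\<dots> \<le> 25 / (128 * n) * (n * (16 * n + 17 / 2 * V))"
  proof (intro mult_left_mono)
    have "V * V \<le> n / 2 * V" using V by (intro mult_right_mono) auto
    then show "M\<^sup>2 \<le> n * (16 * n + 17 / 2 * V)"
      by (simp add: M_def power2_eq_square algebra_simps)
  qed (use n in auto)
  also have "\<dots> = 25 / 128 * (16 * n + 17 / 2 * V)" using n by simp
  finally have 1: "25 / (128 * n) * (1 - 1 / n) * (M\<^sup>2 + 2 * M) \<le> 25 / 128 * (16 * n + 17 / 2 * V)"
    by (simp only: mult.assoc)
  have 2: "L1 * M \<le> 3 / 10 * M" using L M n by (intro mult_right_mono) auto
  have 3: "2 * n * L2 \<le> 2 * n * (129 / 100)" using L n by (intro mult_left_mono) auto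
  have "n / 2 \<le> 15 / 2 * n - 25 / 128 * (16 * n + 17 / 2 * V) - 3 / 10 * M - 2 * n * (129 / 100) + 2 * V"
    using V n by (simp add: M_def field_simps)
  then show ?thesis using 1 2 3 unfolding M_def[symmetric] by linarith
qed

text \<open>The vector 2 sqrt n x is rounded, and its roundings are among the terms of the sum. A
  single scalar event about \<open>mgf_sum\<close> thereby controls all unit vectors at
  once.\<close>

lemma mgf_sum_ge:
  fixes A :: "complex ^ 'n::finite ^ 'n"
  assumes diag: "\<And>i. A $ i $ i = 0" and x: "norm x = 1"
    and q: "3 * sqrt CARD('n) \<le> s * (x \<bullet> (A *v x))"
  shows "exp (CARD('n) / 2) \<le> mgf_sum s A"
proof -
  define n where "n = real CARD('n)"
  have n1: "1 \<le> n" by (simp add: n_def Suc_le_eq)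
  then have n: "0 < n" "0 < sqrt n" "sqrt n * sqrt n = n" by auto
  define \<theta> where "\<theta> = s * (5 / (8 * sqrt n))"
  define lam where "lam = 25 / (128 * n) * (1 - 1 / n)"
  define t :: "'n \<times> bool \<Rightarrow> real" where
    "t a = 2 * sqrt n * (if snd a then Im (x $ fst a) else Re (x $ fst a))" for a
  have t: "cvec t = (2 * sqrt n) *\<^sub>R x"
    by (simp add: cvec_def t_def vec_eq_iff complex_eq_iff)
  have St: "(\<Sum>a\<in>UNIV. (t a)\<^sup>2) = 4 * n"
    using n by (simp add: t x power_mult_distrib flip: cvec_norm)
  have "cvec t \<bullet> (A *v cvec t) = 4 * n * (x \<bullet> (A *v x))"
    using n by (simp add: t matrix_vector_scaleR mult.assoc[symmetric])
  then have Qt: "(\<Sum>a\<in>UNIV. \<Sum>b\<in>UNIV. real_entry A a b * t a * t b) = 4 * n * (x \<bullet> (A *v x))"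
    by (simp only: cvec_quadratic_form)
  define V where "V = (\<Sum>a\<in>UNIV. frac (t a) * (1 - frac (t a)))"
  have V: "0 \<le> V" "V \<le> n / 2"
  proof -
    have *: "0 \<le> frac y * (1 - frac y)" "frac y * (1 - frac y) \<le> 1 / 4" for y :: real
    proof -
      show "0 \<le> frac y * (1 - frac y)" using frac_ge_0[of y] frac_lt_1[of y] by simp
      have "frac y * (1 - frac y) = 1 / 4 - (frac y - 1 / 2)\<^sup>2" by (simp add: power2_eq_square algebra_simps)
      then show "frac y * (1 - frac y) \<le> 1 / 4" by simp
    qed
    show "0 \<le> V" unfolding V_def by (intro sum_nonneg *)
    have "V \<le> (\<Sum>a\<in>(UNIV :: ('n \<times> bool) set). 1 / 4)" unfolding V_def by (intro sum_mono *)
    then show "V \<le> n / 2" by (simp add: n_def)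
  qed
  have lam0: "0 \<le> lam" unfolding lam_def using n1 by (intro mult_nonneg_nonneg) auto
  define h where "h k = grid_weight k * exp (\<theta> * (cvec (\<lambda>a. of_int (k a)) \<bullet> (A *v cvec (\<lambda>a. of_int (k a))))
      - lam * ((norm (cvec (\<lambda>a. of_int (k a))))\<^sup>2)\<^sup>2)" for k :: "'n \<times> bool \<Rightarrow> int"
  have h0: "0 \<le> h k" for k by (simp add: h_def grid_weight_nonneg)
  have "15 / 2 * n \<le> \<theta> * (4 * n * (x \<bullet> (A *v x)))"
  proof -
    have "5 / 2 * sqrt n * (3 * sqrt n) \<le> 5 / 2 * sqrt n * (s * (x \<bullet> (A *v x)))"
      using q n by (intro mult_left_mono) (auto simp: n_def)
    moreover have "5 / 2 * sqrt n * (3 * sqrt n) = 15 / 2 * n" using n by simp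
    moreover have "\<theta> * (4 * n * (x \<bullet> (A *v x))) = 5 / 2 * (n / sqrt n) * (s * (x \<bullet> (A *v x)))"
      by (simp add: \<theta>_def)
    moreover have "n / sqrt n = sqrt n" using n by (simp add: real_div_sqrt)
    ultimately show ?thesis by (simp only:)
  qed
  then have "n / 2 \<le> \<theta> * (4 * n * (x \<bullet> (A *v x))) - lam * ((4 * n + V)\<^sup>2 + 2 * (4 * n + V)) - ln (4 / 3) * (4 * n + V)
      - real CARD('n \<times> bool) * ln (18 / 5) + 2 * V"
  proof -
    have "real CARD('n \<times> bool) = 2 * n" by (simp add: n_def)
    then show ?thesis
      using rounding_numerics[OF n1 V ln_bounds] \<open>15 / 2 * n \<le> _\<close> unfolding lam_def by simp
  qed
  then have "exp (n / 2) \<le> exp (\<theta> * (4 * n * (x \<bullet> (A *v x))) - lam * ((4 * n + V)\<^sup>2 + 2 * (4 * n + V)) - ln (4 / 3) * (4 * n + V)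
      - real CARD('n \<times> bool) * ln (18 / 5) + 2 * V)"
    by simp
  also have "\<dots> \<le> (\<Sum>e\<in>UNIV. h (rounding t e))"
  proof -
    have d: "real_entry A a a = 0" for a by (simp add: real_entry_def diag)
    show ?thesis
      using rounding_lower_bound[where A = "real_entry A" and \<theta> = \<theta> and t = t, OF d lam0]
      unfolding h_def grid_weight_def V_def[symmetric] St Qt cvec_norm cvec_quadratic_form .
  qed
  \<comment> \<open>Different coin patterns give different grid points, so no term is counted
    twice.\<close>
  also have "\<dots> = (\<Sum>k\<in>range (rounding t). h k)"
    by (subst sum.reindex) (auto simp: inj_on_def rounding_def fun_eq_iff)
  also have "\<dots> \<le> (\<Sum>k\<in>grid. h k)"
  proof (intro sum_mono2 finite_grid h0)
    show "range (rounding t) \<subseteq> grid"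
    proof
      fix k assume "k \<in> range (rounding t)"
      then obtain e where k: "k = rounding t e" by blast
      have "k a \<in> {- int (2 * CARD('n \<times> bool) + 1)..int (2 * CARD('n \<times> bool) + 1)}" for a
      proof -
        have "(t a)\<^sup>2 \<le> (\<Sum>a\<in>UNIV. (t a)\<^sup>2)" by (intro member_le_sum) auto
        also have "\<dots> \<le> (2 * n)\<^sup>2" unfolding St using n1 by (simp add: power2_eq_square)
        finally have "\<bar>t a\<bar> \<le> 2 * n" using n1 abs_le_square_iff[of "t a" "2 * n"] by simp
        then have "- real (2 * CARD('n)) \<le> t a" "t a \<le> real (2 * CARD('n))" by (auto simp: n_def)
        then have "- int (2 * CARD('n)) \<le> \<lfloor>t a\<rfloor>" "\<lfloor>t a\<rfloor> \<le> int (2 * CARD('n))"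
          by (auto simp: le_floor_iff floor_le_iff)
        then show ?thesis by (auto simp: k rounding_def)
      qed
      then show "k \<in> grid" unfolding grid_def by auto
    qed
  qed
  also have "\<dots> = mgf_sum s A"
    by (simp add: mgf_sum_def h_def \<theta>_def lam_def n_def)
  finally show ?thesis by (simp add: n_def)
qed

section \<open>Exponential moments of Wigner matrices\<close>

text \<open>Completing the square: the exponential factor shifts the mean of the density to t
  s^2.\<close>

lemma nn_integral_exp_normal:
  assumes s: "0 < s"
  shows "(\<integral>\<^sup>+x. ennreal (normal_density 0 s x) * ennreal (exp (t * x)) \<partial>lborel) = ennreal (exp (t\<^sup>2 * s\<^sup>2 / 2))"
proof -
  have "normal_density 0 s x * exp (t * x) = exp (t\<^sup>2 * s\<^sup>2 / 2) * normal_density (t * s\<^sup>2) s x" for x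
  proof -
    have "- x\<^sup>2 / (2 * s\<^sup>2) + t * x = t\<^sup>2 * s\<^sup>2 / 2 + - (x - t * s\<^sup>2)\<^sup>2 / (2 * s\<^sup>2)"
      using s by (simp add: field_simps power2_eq_square)
    then have "exp (- x\<^sup>2 / (2 * s\<^sup>2)) * exp (t * x) = exp (t\<^sup>2 * s\<^sup>2 / 2) * exp (- (x - t * s\<^sup>2)\<^sup>2 / (2 * s\<^sup>2))"
      unfolding exp_add[symmetric] by (simp only:)
    then show ?thesis by (simp add: normal_density_def)
  qed
  then have "(\<integral>\<^sup>+x. ennreal (normal_density 0 s x) * ennreal (exp (t * x)) \<partial>lborel)
      = (\<integral>\<^sup>+x. ennreal (exp (t\<^sup>2 * s\<^sup>2 / 2)) * ennreal (normal_density (t * s\<^sup>2) s x) \<partial>lborel)"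
    by (simp flip: ennreal_mult)
  also have "\<dots> = ennreal (exp (t\<^sup>2 * s\<^sup>2 / 2)) * (\<integral>\<^sup>+x. ennreal (normal_density (t * s\<^sup>2) s x) \<partial>lborel)"
    by (simp add: nn_integral_cmult)
  also have "(\<integral>\<^sup>+x. ennreal (normal_density (t * s\<^sup>2) s x) \<partial>lborel) = 1"
    using s by (subst nn_integral_eq_integral) auto
  finally show ?thesis by simp
qed

context prob_space
begin

lemma expectation_exp_normal:
  assumes "distributed M lborel X (normal_density 0 (1 / sqrt 2))"
  shows "(\<integral>\<^sup>+\<omega>. ennreal (exp (t * X \<omega>)) \<partial>M) = ennreal (exp (t\<^sup>2 / 4))"
proof -
  have "(\<integral>\<^sup>+\<omega>. ennreal (exp (t * X \<omega>)) \<partial>M)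
      = (\<integral>\<^sup>+x. ennreal (normal_density 0 (1 / sqrt 2) x) * ennreal (exp (t * x)) \<partial>lborel)"
    by (rule distributed_nn_integral[OF assms, symmetric]) simp
  also have "\<dots> = ennreal (exp (t\<^sup>2 / 4))"
    by (subst nn_integral_exp_normal) (auto simp: power_divide)
  finally show ?thesis .
qed

text \<open>The real part of c X combines two independent normal variables of variance 1/2, so its
  variance is |c|^2 / 2.\<close>

lemma expectation_exp_complex_normal:
  assumes "std_complex_normal X"
  shows "(\<integral>\<^sup>+\<omega>. ennreal (exp (Re (c * X \<omega>))) \<partial>M) = ennreal (exp ((cmod c)\<^sup>2 / 4))"
proof -
  have X: "distributed M lborel (\<lambda>\<omega>. Re (X \<omega>)) (normal_density 0 (1 / sqrt 2))"
    "distributed M lborel (\<lambda>\<omega>. Im (X \<omega>)) (normal_density 0 (1 / sqrt 2))"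
    and ind: "indep_var borel (\<lambda>\<omega>. Re (X \<omega>)) borel (\<lambda>\<omega>. Im (X \<omega>))"
    using assms by (auto simp: std_complex_normal_def)
  define f where "f x = ennreal (exp (Re c * x))" for x
  define g where "g x = ennreal (exp (- Im c * x))" for x
  have fg: "f \<in> borel_measurable borel" "g \<in> borel_measurable borel"
    unfolding f_def[abs_def] g_def[abs_def] by measurable
  define Y where "Y = case_bool (f \<circ> (\<lambda>\<omega>. Re (X \<omega>))) (g \<circ> (\<lambda>\<omega>. Im (X \<omega>)))"
  have "indep_var borel (f \<circ> (\<lambda>\<omega>. Re (X \<omega>))) borel (g \<circ> (\<lambda>\<omega>. Im (X \<omega>)))"
    by (rule indep_var_compose[OF ind fg])
  moreover have "case_bool borel borel = (\<lambda>_. borel :: ennreal measure)"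
    by (auto simp: fun_eq_iff split: bool.split)
  ultimately have "indep_vars (\<lambda>_. borel) Y UNIV"
    by (simp add: indep_var_def Y_def)
  then have "(\<integral>\<^sup>+\<omega>. (\<Prod>b\<in>UNIV. Y b \<omega>) \<partial>M) = (\<Prod>b\<in>UNIV. \<integral>\<^sup>+\<omega>. Y b \<omega> \<partial>M)"
    by (intro indep_vars_nn_integral) auto
  then have "(\<integral>\<^sup>+\<omega>. f (Re (X \<omega>)) * g (Im (X \<omega>)) \<partial>M)
      = (\<integral>\<^sup>+\<omega>. f (Re (X \<omega>)) \<partial>M) * (\<integral>\<^sup>+\<omega>. g (Im (X \<omega>)) \<partial>M)"
    by (simp add: UNIV_bool Y_def comp_def mult.commute)
  also have "\<dots> = ennreal (exp ((Re c)\<^sup>2 / 4)) * ennreal (exp ((- Im c)\<^sup>2 / 4))"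
    unfolding f_def g_def by (simp only: expectation_exp_normal[OF X(1)] expectation_exp_normal[OF X(2)])
  also have "\<dots> = ennreal (exp ((cmod c)\<^sup>2 / 4))"
    by (simp add: cmod_power2 add_divide_distrib exp_add ennreal_mult)
  finally have eq: "(\<integral>\<^sup>+\<omega>. f (Re (X \<omega>)) * g (Im (X \<omega>)) \<partial>M) = ennreal (exp ((cmod c)\<^sup>2 / 4))" .
  have "f (Re (X \<omega>)) * g (Im (X \<omega>)) = ennreal (exp (Re (c * X \<omega>)))" for \<omega>
    by (simp add: f_def g_def exp_diff exp_minus divide_inverse flip: ennreal_mult)
  then show ?thesis using eq by simp
qed

lemma markov_real:
  assumes [measurable]: "f \<in> borel_measurable M" and le: "(\<integral>\<^sup>+\<omega>. ennreal (f \<omega>) \<partial>M) \<le> ennreal b"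
    and b: "0 \<le> b" and c: "0 < c"
  shows "prob {\<omega> \<in> space M. c \<le> f \<omega>} \<le> b / c"
proof -
  have "emeasure M {\<omega> \<in> space M. c \<le> f \<omega>} \<le> emeasure M {\<omega> \<in> space M. 1 \<le> ennreal (1 / c) * ennreal (f \<omega>)}"
  proof (intro emeasure_mono subsetI)
    fix \<omega> assume "\<omega> \<in> {\<omega> \<in> space M. c \<le> f \<omega>}"
    then have "\<omega> \<in> space M" "ennreal 1 \<le> ennreal (1 / c * f \<omega>)"
      using c by (auto intro!: ennreal_leI simp: field_simps)
    moreover have "ennreal (1 / c * f \<omega>) = ennreal (1 / c) * ennreal (f \<omega>)"
      using c by (intro ennreal_mult') simp
    ultimately show "\<omega> \<in> {\<omega> \<in> space M. 1 \<le> ennreal (1 / c) * ennreal (f \<omega>)}"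
      by (simp only: mem_Collect_eq ennreal_1)
  qed measurable
  also have "\<dots> \<le> ennreal (1 / c) * (\<integral>\<^sup>+\<omega>. ennreal (f \<omega>) * indicator (space M) \<omega> \<partial>M)"
    using nn_integral_Markov_inequality[of "\<lambda>\<omega>. ennreal (f \<omega>)" "space M" M "ennreal (1 / c)"] by simp
  also have "\<dots> \<le> ennreal (1 / c) * ennreal b"
    using le by (intro mult_left_mono) (auto cong: nn_integral_cong_simp)
  also have "\<dots> = ennreal (b / c)" using b c by (simp flip: ennreal_mult)
  finally show ?thesis using b c by (simp add: emeasure_eq_measure)
qed

end

locale wigner = prob_space M for M :: "'w measure" +
  fixes W :: "'w \<Rightarrow> complex ^ 'n::{finite,linorder} ^ 'n::{finite,linorder}"
  assumes W: "wigner_matrix W"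
begin

lemma W_hermitian: "\<omega> \<in> space M \<Longrightarrow> hermitian (W \<omega>)"
  using W unfolding wigner_matrix_def hermitian_def by blast

lemma W_diag: "\<omega> \<in> space M \<Longrightarrow> W \<omega> $ i $ i = 0"
  using W unfolding wigner_matrix_def by blast

lemma W_normal: "i < j \<Longrightarrow> std_complex_normal (\<lambda>\<omega>. W \<omega> $ i $ j)"
  using W unfolding wigner_matrix_def by blast

lemma W_indep: "indep_vars (\<lambda>_. borel) (\<lambda>(i, j) \<omega>. W \<omega> $ i $ j) {(i, j). i < j}"
  using W unfolding wigner_matrix_def by blast

lemma W_measurable_upper: "i < j \<Longrightarrow> (\<lambda>\<omega>. W \<omega> $ i $ j) \<in> borel_measurable M"
  using W_indep unfolding indep_vars_def by auto

lemma W_measurable [measurable]: "(\<lambda>\<omega>. W \<omega> $ i $ j) \<in> borel_measurable M"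
proof (cases i j rule: linorder_cases)
  case less
  then show ?thesis by (rule W_measurable_upper)
next
  case equal
  then have "(\<lambda>\<omega>. W \<omega> $ i $ j) \<in> borel_measurable M \<longleftrightarrow> (\<lambda>_. 0 :: complex) \<in> borel_measurable M"
    by (intro measurable_cong) (simp add: W_diag)
  then show ?thesis by simp
next
  case greater
  then have "(\<lambda>\<omega>. W \<omega> $ i $ j) \<in> borel_measurable M \<longleftrightarrow> (\<lambda>\<omega>. cnj (W \<omega> $ j $ i)) \<in> borel_measurable M"
    by (intro measurable_cong) (use W_hermitian in \<open>unfold hermitian_def, blast\<close>)
  then show ?thesis
    using borel_measurable_continuous_on[OF _ W_measurable_upper[OF greater], of cnj]
    by (simp add: continuous_on_cnj)
qed

lemma expectation_exp_upper:
  "(\<integral>\<^sup>+\<omega>. ennreal (exp (\<Sum>(i, j)\<in>{(i, j). i < j}. Re (c i j * W \<omega> $ i $ j))) \<partial>M)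
    = ennreal (exp (\<Sum>(i, j)\<in>{(i, j). i < j}. (cmod (c i j))\<^sup>2 / 4))"
proof -
  let ?D = "{(i, j). i < j} :: ('n \<times> 'n) set"
  define Y where "Y p w = ennreal (exp (Re (c (fst p) (snd p) * w)))" for p and w :: complex
  have "Y p \<in> borel_measurable borel" for p unfolding Y_def by measurable
  then have "indep_vars (\<lambda>_. borel) (\<lambda>p \<omega>. Y p ((case p of (i, j) \<Rightarrow> \<lambda>\<omega>. W \<omega> $ i $ j) \<omega>)) ?D"
    by (intro indep_vars_compose2[OF W_indep]) auto
  then have "(\<integral>\<^sup>+\<omega>. (\<Prod>p\<in>?D. Y p ((case p of (i, j) \<Rightarrow> \<lambda>\<omega>. W \<omega> $ i $ j) \<omega>)) \<partial>M)
      = (\<Prod>p\<in>?D. \<integral>\<^sup>+\<omega>. Y p ((case p of (i, j) \<Rightarrow> \<lambda>\<omega>. W \<omega> $ i $ j) \<omega>) \<partial>M)"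
    by (intro indep_vars_nn_integral) auto
  also have "\<dots> = (\<Prod>p\<in>?D. ennreal (exp ((cmod (c (fst p) (snd p)))\<^sup>2 / 4)))"
  proof (intro prod.cong refl, clarify)
    fix i j :: 'n assume "i < j"
    then show "(\<integral>\<^sup>+\<omega>. Y (i, j) (W \<omega> $ i $ j) \<partial>M) = ennreal (exp ((cmod (c (fst (i, j)) (snd (i, j))))\<^sup>2 / 4))"
      unfolding Y_def by (intro expectation_exp_complex_normal W_normal)
  qed
  also have "\<dots> = ennreal (exp (\<Sum>(i, j)\<in>?D. (cmod (c i j))\<^sup>2 / 4))"
    by (simp add: prod_ennreal exp_sum case_prod_unfold)
  finally have eq: "(\<integral>\<^sup>+\<omega>. (\<Prod>p\<in>?D. Y p ((case p of (i, j) \<Rightarrow> \<lambda>\<omega>. W \<omega> $ i $ j) \<omega>)) \<partial>M)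
      = ennreal (exp (\<Sum>(i, j)\<in>?D. (cmod (c i j))\<^sup>2 / 4))" .
  have "(\<Prod>p\<in>?D. Y p ((case p of (i, j) \<Rightarrow> \<lambda>\<omega>. W \<omega> $ i $ j) \<omega>))
      = ennreal (exp (\<Sum>(i, j)\<in>?D. Re (c i j * W \<omega> $ i $ j)))" for \<omega>
    by (simp add: Y_def prod_ennreal exp_sum case_prod_unfold)
  then show ?thesis unfolding eq[symmetric] by simp
qed

end

lemma quadratic_form_entries:
  "x \<bullet> (A *v x) = (\<Sum>i\<in>UNIV. \<Sum>j\<in>UNIV. Re (cnj (x $ i) * x $ j * A $ i $ j))" for x :: "complex ^ 'n"
  by (simp add: inner_vec_complex herm_inner_def matrix_vector_mult_def sum_distrib_left Re_sum mult_ac)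

lemma sum_pairs_split:
  fixes f :: "'n::{finite,linorder} \<Rightarrow> 'n \<Rightarrow> real"
  assumes "\<And>i. f i i = 0"
  shows "(\<Sum>i\<in>UNIV. \<Sum>j\<in>UNIV. f i j) = (\<Sum>(i, j)\<in>{(i, j). i < j}. f i j + f j i)"
proof -
  have "(\<Sum>i\<in>UNIV. \<Sum>j\<in>UNIV. f i j) = (\<Sum>(i, j)\<in>UNIV. f i j)"
    by (simp add: sum.cartesian_product)
  also have "\<dots> = (\<Sum>(i, j)\<in>{(i, j). i < j} \<union> {(i, j). j < i}. f i j)"
    by (intro sum.mono_neutral_right) (auto simp: assms not_less_iff_gr_or_eq)
  also have "\<dots> = (\<Sum>(i, j)\<in>{(i, j). i < j}. f i j) + (\<Sum>(i, j)\<in>{(i, j). j < i}. f i j)"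
    by (intro sum.union_disjoint) auto
  also have "(\<Sum>(i, j)\<in>{(i, j). j < i}. f i j) = (\<Sum>(i, j)\<in>{(i, j). i < j}. f j i)"
    by (rule sum.reindex_bij_witness[of _ prod.swap prod.swap]) auto
  finally show ?thesis by (simp add: sum.distrib case_prod_unfold)
qed

context wigner
begin

text \<open>The entries at (i, j) and (j, i) are conjugate, so both coefficients act on the same
  independent variable and merge into \<open>a i j + cnj (a j i)\<close>.\<close>

lemma expectation_exp_linear_form:
  "(\<integral>\<^sup>+\<omega>. ennreal (exp (\<Sum>i\<in>UNIV. \<Sum>j\<in>UNIV. Re (a i j * W \<omega> $ i $ j))) \<partial>M)
    = ennreal (exp (\<Sum>(i, j)\<in>{(i, j). i < j}. (cmod (a i j + cnj (a j i)))\<^sup>2 / 4))"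
proof -
  have "(\<Sum>i\<in>UNIV. \<Sum>j\<in>UNIV. Re (a i j * W \<omega> $ i $ j))
      = (\<Sum>(i, j)\<in>{(i, j). i < j}. Re ((a i j + cnj (a j i)) * W \<omega> $ i $ j))" if "\<omega> \<in> space M" for \<omega>
  proof -
    have h: "W \<omega> $ j $ i = cnj (W \<omega> $ i $ j)" for i j
      using W_hermitian[OF that] unfolding hermitian_def by blast
    have "Re (a i j * W \<omega> $ i $ j) + Re (a j i * W \<omega> $ j $ i) = Re ((a i j + cnj (a j i)) * W \<omega> $ i $ j)" for i j
      unfolding h[of i j] by (simp add: algebra_simps)
    then show ?thesis
      by (subst sum_pairs_split) (simp_all add: W_diag[OF that])
  qed
  then have "(\<integral>\<^sup>+\<omega>. ennreal (exp (\<Sum>i\<in>UNIV. \<Sum>j\<in>UNIV. Re (a i j * W \<omega> $ i $ j))) \<partial>M)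
      = (\<integral>\<^sup>+\<omega>. ennreal (exp (\<Sum>(i, j)\<in>{(i, j). i < j}. Re ((a i j + cnj (a j i)) * W \<omega> $ i $ j))) \<partial>M)"
    by (intro nn_integral_cong) simp
  then show ?thesis by (simp only: expectation_exp_upper)
qed

text \<open>The exponent is \<theta>^2 times the sum of \<open>y i * y j\<close> over i < j, that
  is, \<theta>^2 / 2 times the squared total minus the sum of squares. Cauchy-Schwarz bounds the
  latter below, so the missing diagonal yields the factor 1 - 1/n.\<close>

lemma expectation_exp_quadratic_form:
  "(\<integral>\<^sup>+\<omega>. ennreal (exp (\<theta> * (x \<bullet> (W \<omega> *v x)))) \<partial>M)
    \<le> ennreal (exp (\<theta>\<^sup>2 / 2 * (1 - 1 / CARD('n)) * ((norm x)\<^sup>2)\<^sup>2))"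
proof -
  define y where "y i = (cmod (x $ i))\<^sup>2" for i
  have "(\<integral>\<^sup>+\<omega>. ennreal (exp (\<theta> * (x \<bullet> (W \<omega> *v x)))) \<partial>M)
      = (\<integral>\<^sup>+\<omega>. ennreal (exp (\<Sum>i\<in>UNIV. \<Sum>j\<in>UNIV. Re ((of_real \<theta> * cnj (x $ i) * x $ j) * W \<omega> $ i $ j))) \<partial>M)"
    by (simp add: quadratic_form_entries sum_distrib_left mult.assoc)
  also have "\<dots> = ennreal (exp (\<Sum>(i, j)\<in>{(i, j). i < j}.
      (cmod (of_real \<theta> * cnj (x $ i) * x $ j + cnj (of_real \<theta> * cnj (x $ j) * x $ i)))\<^sup>2 / 4))"
    by (rule expectation_exp_linear_form)
  also have "(\<Sum>(i, j)\<in>{(i, j). i < j}.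
      (cmod (of_real \<theta> * cnj (x $ i) * x $ j + cnj (of_real \<theta> * cnj (x $ j) * x $ i)))\<^sup>2 / 4)
      = (\<Sum>(i, j)\<in>{(i, j). i < j}. \<theta>\<^sup>2 * y i * y j)"
  proof (intro sum.cong refl, clarify)
    fix i j :: 'n
    have "of_real \<theta> * cnj (x $ i) * x $ j + cnj (of_real \<theta> * cnj (x $ j) * x $ i)
        = 2 * (of_real \<theta> * cnj (x $ i) * x $ j)" by simp
    then show "(cmod (of_real \<theta> * cnj (x $ i) * x $ j + cnj (of_real \<theta> * cnj (x $ j) * x $ i)))\<^sup>2 / 4 = \<theta>\<^sup>2 * y i * y j"
      by (simp only:) (simp add: norm_mult power_mult_distrib y_def)
  qed
  also have "(\<Sum>(i, j)\<in>{(i, j). i < j}. \<theta>\<^sup>2 * y i * y j) \<le> \<theta>\<^sup>2 / 2 * (1 - 1 / CARD('n)) * ((norm x)\<^sup>2)\<^sup>2"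
  proof -
    define s where "s = (\<Sum>i\<in>UNIV. y i)"
    have nx: "(norm x)\<^sup>2 = s" by (simp add: s_def y_def norm_vec_sqr)
    define f where "f i j = (if i = j then 0 else \<theta>\<^sup>2 * y i * y j)" for i j
    have "2 * (\<Sum>(i, j)\<in>{(i, j). i < j}. \<theta>\<^sup>2 * y i * y j) = (\<Sum>(i, j)\<in>{(i, j). i < j}. f i j + f j i)"
      unfolding sum_distrib_left by (intro sum.cong) (auto simp: f_def)
    also have "\<dots> = (\<Sum>i\<in>UNIV. \<Sum>j\<in>UNIV. f i j)"
      by (rule sum_pairs_split[symmetric]) (simp add: f_def)
    also have "\<dots> = (\<Sum>i\<in>UNIV. \<Sum>j\<in>UNIV. \<theta>\<^sup>2 * (y i * y j) - (if i = j then \<theta>\<^sup>2 * (y i)\<^sup>2 else 0))"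
      by (intro sum.cong refl) (auto simp: f_def power2_eq_square)
    also have "\<dots> = \<theta>\<^sup>2 * (s\<^sup>2 - (\<Sum>i\<in>UNIV. (y i)\<^sup>2))"
      by (simp add: sum_subtractf s_def power2_eq_square[of "sum _ _"] sum_product right_diff_distrib flip: sum_distrib_left)
    also have "\<dots> \<le> \<theta>\<^sup>2 * (s\<^sup>2 - s\<^sup>2 / CARD('n))"
    proof (intro mult_left_mono diff_left_mono)
      have "s\<^sup>2 \<le> (\<Sum>i\<in>UNIV. (y i)\<^sup>2) * CARD('n)"
        unfolding s_def using sum_squared_le_sum_of_squares[of y "UNIV :: 'n set"] by (simp add: mult.commute)
      then show "s\<^sup>2 / CARD('n) \<le> (\<Sum>i\<in>UNIV. (y i)\<^sup>2)"
        by (simp add: pos_divide_le_eq)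
    qed simp
    finally show ?thesis unfolding nx by (simp add: algebra_simps)
  qed
  finally show ?thesis by (simp add: ennreal_leI)
qed

lemma quadratic_form_measurable [measurable]: "(\<lambda>\<omega>. x \<bullet> (W \<omega> *v x)) \<in> borel_measurable M"
  unfolding quadratic_form_entries by measurable

text \<open>The subtracted term in \<open>mgf_sum\<close> cancels the moment bound of
  \<open>expectation_exp_quadratic_form\<close>, so each summand has mean at most its grid weight;
  Markov's inequality finishes.\<close>

lemma prob_mgf_sum_le:
  assumes s: "s\<^sup>2 = 1"
  shows "(\<lambda>\<omega>. mgf_sum s (W \<omega>)) \<in> borel_measurable M"
    and "prob {\<omega> \<in> space M. exp (CARD('n) / 2) \<le> mgf_sum s (W \<omega>)} \<le> exp (- (CARD('n) / 2))"
proof -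
  show meas: "(\<lambda>\<omega>. mgf_sum s (W \<omega>)) \<in> borel_measurable M"
    unfolding mgf_sum_def by measurable
  define v where "v k = cvec (\<lambda>a. of_int (k a))" for k :: "'n \<times> bool \<Rightarrow> int"
  define \<theta> where "\<theta> = s * (5 / (8 * sqrt CARD('n)))"
  define lam where "lam = 25 / (128 * real CARD('n)) * (1 - 1 / CARD('n))"
  have lam: "\<theta>\<^sup>2 / 2 * (1 - 1 / CARD('n)) = lam"
    by (simp add: \<theta>_def lam_def power_mult_distrib power_divide s)
  define u where "u k = grid_weight k * exp (- lam * ((norm (v k))\<^sup>2)\<^sup>2)" for k
  have u0: "0 \<le> u k" for k by (simp add: u_def grid_weight_nonneg)
  have "mgf_sum s A = (\<Sum>k\<in>grid. u k * exp (\<theta> * (v k \<bullet> (A *v v k))))" for A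
  proof -
    have "mgf_sum s A = (\<Sum>k\<in>grid. grid_weight k * exp (\<theta> * (v k \<bullet> (A *v v k)) - lam * ((norm (v k))\<^sup>2)\<^sup>2))"
      unfolding mgf_sum_def v_def \<theta>_def lam_def ..
    also have "\<dots> = (\<Sum>k\<in>grid. u k * exp (\<theta> * (v k \<bullet> (A *v v k))))"
      by (intro sum.cong refl) (simp add: u_def exp_diff exp_minus divide_inverse)
    finally show ?thesis .
  qed
  then have "ennreal (mgf_sum s A) = (\<Sum>k\<in>grid. ennreal (u k) * ennreal (exp (\<theta> * (v k \<bullet> (A *v v k)))))" for A
    using u0 by (simp add: ennreal_mult[symmetric] sum_ennreal)
  then have "(\<integral>\<^sup>+\<omega>. ennreal (mgf_sum s (W \<omega>)) \<partial>M)
      = (\<integral>\<^sup>+\<omega>. (\<Sum>k\<in>grid. ennreal (u k) * ennreal (exp (\<theta> * (v k \<bullet> (W \<omega> *v v k))))) \<partial>M)"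
    by simp
  also have "\<dots> = (\<Sum>k\<in>grid. ennreal (u k) *
          (\<integral>\<^sup>+\<omega>. ennreal (exp (\<theta> * (v k \<bullet> (W \<omega> *v v k)))) \<partial>M))"
    by (simp add: nn_integral_sum nn_integral_cmult)
  also have "\<dots> \<le> (\<Sum>k\<in>grid. ennreal (u k) *
          ennreal (exp (lam * ((norm (v k))\<^sup>2)\<^sup>2)))"
    using expectation_exp_quadratic_form[of \<theta>] unfolding lam by (intro sum_mono mult_left_mono) auto
  also have "\<dots> = (\<Sum>k\<in>(grid :: ('n \<times> bool \<Rightarrow> int) set). ennreal (grid_weight k))"
    by (intro sum.cong refl) (simp add: u_def grid_weight_nonneg exp_minus flip: ennreal_mult)
  also have "\<dots> \<le> ennreal 1"
    using sum_grid_weight_le by (simp add: grid_weight_nonneg flip: ennreal_1)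
  finally have "prob {\<omega> \<in> space M. exp (CARD('n) / 2) \<le> mgf_sum s (W \<omega>)} \<le> 1 / exp (CARD('n) / 2)"
    by (intro markov_real meas) auto
  also have "1 / exp (CARD('n) / 2) = exp (- (CARD('n) / 2))"
    by (rule exp_minus'[symmetric])
  finally show "prob {\<omega> \<in> space M. exp (CARD('n) / 2) \<le> mgf_sum s (W \<omega>)} \<le> exp (- (CARD('n) / 2))" .
qed

lemma expectation_exp_row:
  assumes z: "\<And>k. cmod (z $ k) = 1" and e: "cmod e = 1"
  shows "(\<integral>\<^sup>+\<omega>. ennreal (exp (l * (e \<bullet> (W \<omega> *v z) $ j))) \<partial>M) \<le> ennreal (exp (l\<^sup>2 * CARD('n) / 4))"
proof -
  define a where "a i k = (if i = j then of_real l * cnj e * z $ k else 0)" for i k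
  have "l * (e \<bullet> (W \<omega> *v z) $ j) = (\<Sum>i\<in>UNIV. \<Sum>k\<in>UNIV. Re (a i k * W \<omega> $ i $ k))" for \<omega>
  proof -
    have "(\<Sum>i\<in>UNIV. \<Sum>k\<in>UNIV. Re (a i k * W \<omega> $ i $ k))
        = (\<Sum>i\<in>UNIV. if i = j then \<Sum>k\<in>UNIV. Re (of_real l * cnj e * z $ k * W \<omega> $ i $ k) else 0)"
      by (intro sum.cong refl) (auto simp: a_def)
    also have "\<dots> = (\<Sum>k\<in>UNIV. Re (of_real l * cnj e * z $ k * W \<omega> $ j $ k))"
      by simp
    also have "\<dots> = (\<Sum>k\<in>UNIV. l * (e \<bullet> (W \<omega> $ j $ k * z $ k)))"
      by (intro sum.cong refl) (simp add: inner_complex_def algebra_simps)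
    also have "\<dots> = l * (e \<bullet> (W \<omega> *v z) $ j)"
      by (simp add: matrix_vector_mult_def inner_sum_right sum_distrib_left)
    finally show ?thesis by simp
  qed
  then have "(\<integral>\<^sup>+\<omega>. ennreal (exp (l * (e \<bullet> (W \<omega> *v z) $ j))) \<partial>M)
      = ennreal (exp (\<Sum>(i, k)\<in>{(i, k). i < k}. (cmod (a i k + cnj (a k i)))\<^sup>2 / 4))"
    by (simp only: expectation_exp_linear_form)
  also have "\<dots> \<le> ennreal (exp (l\<^sup>2 * CARD('n) / 4))"
  proof -
    \<comment> \<open>For i < k, \<open>g i k + g k i\<close> is l^2 / 4 exactly when the pair
      contains j, which makes the sum over pairs a sum over one row.\<close>
    define g where "g i k = (if i = k then 0 else if i = j then l\<^sup>2 / 4 else 0)" for i k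
    have "(\<Sum>(i, k)\<in>{(i, k). i < k}. (cmod (a i k + cnj (a k i)))\<^sup>2 / 4) \<le> (\<Sum>(i, k)\<in>{(i, k). i < k}. g i k + g k i)"
      by (intro sum_mono) (auto simp: a_def g_def norm_mult z e)
    also have "\<dots> = (\<Sum>i\<in>UNIV. \<Sum>k\<in>UNIV. g i k)"
      by (rule sum_pairs_split[symmetric]) (simp add: g_def)
    also have "\<dots> \<le> (\<Sum>i\<in>UNIV. if i = j then CARD('n) * (l\<^sup>2 / 4) else 0)"
    proof (rule sum_mono)
      fix i
      have "(\<Sum>k\<in>UNIV. g i k) \<le> (\<Sum>k\<in>(UNIV :: 'n set). if i = j then l\<^sup>2 / 4 else 0)"
        by (intro sum_mono) (simp add: g_def)
      then show "(\<Sum>k\<in>UNIV. g i k) \<le> (if i = j then CARD('n) * (l\<^sup>2 / 4) else 0)"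
        by (cases "i = j") simp_all
    qed
    also have "\<dots> = l\<^sup>2 * CARD('n) / 4" by simp
    finally show ?thesis by (intro ennreal_leI) simp
  qed
  finally show ?thesis .
qed

lemma row_measurable [measurable]: "(\<lambda>\<omega>. e \<bullet> (W \<omega> *v z) $ j) \<in> borel_measurable M"
  unfolding matrix_vector_mult_def by simp measurable

lemma prob_row_ge:
  fixes n t :: real
  assumes z: "\<And>k. cmod (z $ k) = 1" and e: "cmod e = 1" and n: "n = CARD('n)" and t: "0 < t"
  shows "prob {\<omega> \<in> space M. t \<le> e \<bullet> (W \<omega> *v z) $ j} \<le> exp (- t\<^sup>2 / n)"
proof -
  have n0: "0 < n" by (simp add: n)
  \<comment> \<open>The minimiser of l^2 n / 4 - l t in the Chernoff bound.\<close>
  define l where "l = 2 * t / n"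
  have l: "0 < l" using t n0 by (simp add: l_def)
  have "prob {\<omega> \<in> space M. exp (l * t) \<le> exp (l * (e \<bullet> (W \<omega> *v z) $ j))} \<le> exp (l\<^sup>2 * n / 4) / exp (l * t)"
    unfolding n by (rule markov_real[OF _ expectation_exp_row[OF z e]]) auto
  also have "\<dots> = exp (l\<^sup>2 * n / 4 - l * t)" by (simp add: exp_diff)
  also have "l\<^sup>2 * n / 4 - l * t = - t\<^sup>2 / n" using n0 by (simp add: l_def field_simps power2_eq_square)
  finally show ?thesis using l by simp
qed

text \<open>The two signs of the quadratic form cost 2 exp (- n / 2). The 4n tail events, four
  directions for each row, cost 4 n^(-7/2), which is at most 2 n^(-5/4) because 2 \<le>
  n^(9/4).\<close>

lemma regular_event:
  fixes n :: real
  assumes z: "\<And>k. cmod (z $ k) = 1" and n: "n = CARD('n)" and n2: "2 \<le> n"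
  shows "\<exists>E\<in>sets M. prob E \<ge> 1 - 2 * n powr (- 5 / 4) - 2 * exp (- n / 2) \<and>
    (\<forall>\<omega>\<in>E. (\<forall>x. norm (W \<omega> *v x) \<le> 3 * sqrt n * norm x) \<and>
      (\<forall>j. cmod ((W \<omega> *v z) $ j) \<le> 3 * sqrt (n * ln n)))"
proof -
  \<comment> \<open>Real and imaginary parts of modulus at most t bound the entry by sqrt 2 t = 3
    sqrt (n ln n).\<close>
  define t where "t = sqrt (9 / 2 * (n * ln n))"
  have nl: "0 < n * ln n" using n2 by simp
  have t: "0 < t" "t\<^sup>2 = 9 / 2 * (n * ln n)" using nl by (simp_all add: t_def)
  define B where "B s = {\<omega> \<in> space M. exp (CARD('n) / 2) \<le> mgf_sum s (W \<omega>)}" for s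
  define D where "D p = {\<omega> \<in> space M. t \<le> snd p \<bullet> (W \<omega> *v z) $ fst p}" for p
  define R where "R = (UNIV :: 'n set) \<times> {1, -1, \<i>, -\<i>}"
  have B_sets: "B 1 \<in> sets M" "B (-1) \<in> sets M"
    using prob_mgf_sum_le(1)[of 1] prob_mgf_sum_le(1)[of "-1"] unfolding B_def by measurable
  have D_sets: "D p \<in> sets M" for p unfolding D_def by measurable
  have finR: "finite R" by (simp add: R_def)
  define U where "U = (\<Union>p\<in>R. D p)"
  have U_sets: "U \<in> sets M" unfolding U_def using finR D_sets by auto
  have "prob U \<le> (\<Sum>p\<in>R. prob (D p))"
    unfolding U_def using finR D_sets by (intro finite_measure_subadditive_finite) auto
  also have "\<dots> \<le> (\<Sum>p\<in>R. n powr (- 9 / 2))"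
  proof (rule sum_mono)
    fix p assume "p \<in> R"
    then have "cmod (snd p) = 1" by (auto simp: R_def)
    then have "prob (D p) \<le> exp (- t\<^sup>2 / n)"
      unfolding D_def by (intro prob_row_ge z n t)
    also have "- t\<^sup>2 / n = - 9 / 2 * ln n" using n2 by (simp add: t)
    also have "exp (- 9 / 2 * ln n) = n powr (- 9 / 2)" using n2 by (simp add: powr_def)
    finally show "prob (D p) \<le> n powr (- 9 / 2)" .
  qed
  also have "\<dots> \<le> 4 * n * n powr (- 9 / 2)"
  proof -
    have "card {1, -1, \<i>, -\<i>} \<le> 4" by (simp add: card_insert_if)
    then have "card R \<le> CARD('n) * 4" unfolding R_def card_cartesian_product by (intro mult_le_mono) auto
    then have "real (card R) \<le> 4 * n" by (simp add: n)
    then show ?thesis by (simp add: mult_right_mono)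
  qed
  also have "\<dots> \<le> 2 * n powr (- 5 / 4)"
  proof -
    have "2 powr 1 \<le> n powr (9 / 4)" using n2 by (intro powr_mono_both) auto
    then have "2 * n powr (- 7 / 2) \<le> n powr (9 / 4) * n powr (- 7 / 2)"
      by (intro mult_right_mono) auto
    also have "\<dots> = n powr (- 5 / 4)" by (simp flip: powr_add)
    finally have "4 * n powr (- 7 / 2) \<le> 2 * n powr (- 5 / 4)" by simp
    moreover have "n * n powr (- 9 / 2) = n powr (- 7 / 2)"
      using n2 powr_add[of n 1 "- 9 / 2"] by simp
    ultimately show ?thesis by (simp add: mult.assoc)
  qed
  finally have pU: "prob U \<le> 2 * n powr (- 5 / 4)" .
  have pB: "prob (B 1) \<le> exp (- n / 2)" "prob (B (-1)) \<le> exp (- n / 2)"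
    using prob_mgf_sum_le(2)[of 1] prob_mgf_sum_le(2)[of "-1"] by (simp_all add: B_def n)
  define E where "E = space M - (B 1 \<union> B (-1) \<union> U)"
  have E_sets: "E \<in> sets M" unfolding E_def using B_sets U_sets by auto
  have "prob (B 1 \<union> B (-1) \<union> U) \<le> prob (B 1) + prob (B (-1)) + prob U"
    using measure_Un_le[of "B 1 \<union> B (-1)" M U] measure_Un_le[of "B 1" M "B (-1)"] B_sets U_sets by simp
  moreover have "prob E = 1 - prob (B 1 \<union> B (-1) \<union> U)"
    unfolding E_def using B_sets U_sets by (intro prob_compl) auto
  ultimately have pE: "prob E \<ge> 1 - 2 * n powr (- 5 / 4) - 2 * exp (- n / 2)"
    using pU pB by linarith
  have "(\<forall>x. norm (W \<omega> *v x) \<le> 3 * sqrt n * norm x) \<and> (\<forall>j. cmod ((W \<omega> *v z) $ j) \<le> 3 * sqrt (n * ln n))"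
    if "\<omega> \<in> E" for \<omega>
  proof (intro conjI allI)
    have \<omega>: "\<omega> \<in> space M" "\<omega> \<notin> B 1" "\<omega> \<notin> B (-1)" "\<omega> \<notin> U"
      using that by (auto simp: E_def)
    have unit: "\<bar>x \<bullet> (W \<omega> *v x)\<bar> \<le> 3 * sqrt n" if "norm x = 1" for x
    proof -
      have "s * (x \<bullet> (W \<omega> *v x)) < 3 * sqrt n" if "\<omega> \<notin> B s" for s
        using mgf_sum_ge[of "W \<omega>" x s, OF W_diag[OF \<omega>(1)] \<open>norm x = 1\<close>] that \<omega>(1)
        by (force simp: B_def n)
      from this[OF \<omega>(2)] this[OF \<omega>(3)] show ?thesis by (simp add: abs_le_iff)
    qed
    have quad: "\<bar>x \<bullet> (W \<omega> *v x)\<bar> \<le> 3 * sqrt n * (norm x)\<^sup>2" for x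
    proof (cases "x = 0")
      case False
      have "\<bar>(x /\<^sub>R norm x) \<bullet> (W \<omega> *v (x /\<^sub>R norm x))\<bar> \<le> 3 * sqrt n"
        using False by (intro unit) simp
      moreover have "(x /\<^sub>R norm x) \<bullet> (W \<omega> *v (x /\<^sub>R norm x)) = (x \<bullet> (W \<omega> *v x)) / (norm x)\<^sup>2"
        by (simp add: matrix_vector_scaleR power2_eq_square field_simps)
      ultimately have "\<bar>x \<bullet> (W \<omega> *v x)\<bar> / (norm x)\<^sup>2 \<le> 3 * sqrt n" by (simp only: abs_divide) simp
      with False show ?thesis by (simp add: pos_divide_le_eq)
    qed simp
    show "norm (W \<omega> *v x) \<le> 3 * sqrt n * norm x" for x
      by (rule hermitian_norm_le[OF W_hermitian[OF \<omega>(1)] quad])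
    show "cmod ((W \<omega> *v z) $ j) \<le> 3 * sqrt (n * ln n)" for j
    proof -
      define y where "y = (W \<omega> *v z) $ j"
      have dir: "e \<bullet> y < t" if "e \<in> {1, -1, \<i>, -\<i>}" for e
      proof -
        have "(j, e) \<in> R" using that by (simp add: R_def)
        then have "\<omega> \<notin> D (j, e)" using \<omega>(4) by (auto simp: U_def)
        then show ?thesis using \<omega>(1) by (simp add: D_def y_def)
      qed
      have "\<bar>Re y\<bar> \<le> t" "\<bar>Im y\<bar> \<le> t"
        using dir[of 1] dir[of "-1"] dir[of \<i>] dir[of "-\<i>"] by (auto simp: inner_complex_def)
      then have "(Re y)\<^sup>2 \<le> t\<^sup>2" "(Im y)\<^sup>2 \<le> t\<^sup>2"
        using t(1) by (simp_all add: abs_le_square_iff[symmetric])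
      then have "(cmod y)\<^sup>2 \<le> 9 * (n * ln n)" using t(2) by (simp add: cmod_power2)
      also have "\<dots> = (3 * sqrt (n * ln n))\<^sup>2" using nl by (simp add: power_mult_distrib)
      finally have "cmod y \<le> 3 * sqrt (n * ln n)" by (rule power2_le_imp_le) (use nl in simp)
      then show ?thesis by (simp add: y_def)
    qed
  qed
  with E_sets pE show ?thesis by blast
qed

end

section \<open>Deterministic bounds on the good event\<close>

theorem corollary1:
  fixes M :: "'w measure"
    and zstar :: "complex ^ 'n::{finite,linorder}"
    and W C :: "'w \<Rightarrow> complex ^ 'n::{finite,linorder} ^ 'n::{finite,linorder}"
    and z0 :: "'w \<Rightarrow> complex ^ 'n::{finite,linorder}"
    and \<sigma> \<alpha> n :: real
  assumes n: "n = real CARD('n)"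
    and M: "prob_space M"
    and zstar: "zstar \<in> torus"
    and W: "prob_space.wigner_matrix M W"
    and \<sigma>: "0 < \<sigma>" "\<sigma> \<le> sqrt n / 48"
    and C: "\<And>\<omega>. \<omega> \<in> space M \<Longrightarrow> C \<omega> = herm_outer zstar zstar + \<sigma> *\<^sub>R W \<omega>"
    and \<alpha>: "\<alpha> \<ge> 2"
    and z0: "\<And>\<omega>. \<omega> \<in> space M \<Longrightarrow> eigenvector_estimator (C \<omega>) (z0 \<omega>)"
  shows "\<exists>E\<in>sets M.
    measure M E \<ge> 1 - 2 * n powr (- 5 / 4) - 2 * exp (- n / 2) \<and>
    (\<forall>\<omega>\<in>E. \<forall>k::nat.
      phase_dist 2 (gpm (C \<omega>) \<alpha> (z0 \<omega>) (k + 1)) zstar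
        \<le> ((\<alpha> + 16) / (7 * \<alpha> + 8)) ^ (k + 1) * phase_dist 2 (z0 \<omega>) zstar
          + 24 * \<alpha> / (3 * \<alpha> - 4) * \<sigma> \<and>
      phase_dist \<infinity> (gpm (C \<omega>) \<alpha> (z0 \<omega>) (k + 1)) zstar
        \<le> (16 / (7 * \<alpha> + 8)) ^ (k + 1) * phase_dist \<infinity> (z0 \<omega>) zstar
          + ((\<alpha> + 16) / (7 * \<alpha> + 8)) ^ (k + 1) * (sqrt n / 2)
          + 48 * \<alpha> / (7 * \<alpha> + 8) * (sqrt (ln n) + 24 * \<alpha> / (3 * \<alpha> - 4) * \<sigma>)
            * (\<sigma> / sqrt n))"
proof (cases "2 \<le> n")
  case False
  then have "CARD('n) < 2" using n by simp
  moreover have "0 < CARD('n)" by simp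
  ultimately have "CARD('n) = 1" by linarith
  \<comment> \<open>For n = 1 the claimed probability is negative and the empty event will
    do.\<close>
  then have "1 - 2 * n powr (- 5 / 4) = - 1" using n by simp
  then have "1 - 2 * n powr (- 5 / 4) - 2 * exp (- n / 2) \<le> measure M {}"
    using exp_gt_zero[of "- n / 2"] unfolding measure_empty by linarith
  then show ?thesis by blast
next
  case True
  interpret wigner M W using M W by (simp add: wigner_def wigner_axioms_def)
  have zs: "cmod (zstar $ j) = 1" for j using zstar by (simp add: torus_def)
  \<comment> \<open>The event is determined by \<open>W\<close> and \<open>zstar\<close> alone, so
    on it the bounds hold for every choice of leading eigenvector and auxiliary vector.\<close>
  obtain E where E: "E \<in> sets M" "prob E \<ge> 1 - 2 * n powr (- 5 / 4) - 2 * exp (- n / 2)"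
    and reg: "\<And>\<omega>. \<omega> \<in> E \<Longrightarrow> (\<forall>x. norm (W \<omega> *v x) \<le> 3 * sqrt n * norm x) \<and>
      (\<forall>j. cmod ((W \<omega> *v zstar) $ j) \<le> 3 * sqrt (n * ln n))"
    using regular_event[OF zs n True] by blast
  show ?thesis
  proof (intro bexI conjI ballI allI)
    show "E \<in> sets M" by (rule E)
    show "1 - 2 * n powr (- 5 / 4) - 2 * exp (- n / 2) \<le> prob E" by (rule E)
    fix \<omega> k
    assume \<omega>E: "\<omega> \<in> E"
    then have \<omega>: "\<omega> \<in> space M" using sets.sets_into_space[OF E(1)] by blast
    interpret ps: phase_sync zstar "\<sigma> *\<^sub>R W \<omega>" n \<sigma> \<alpha>
    proof
      show "hermitian (\<sigma> *\<^sub>R W \<omega>)"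
        unfolding hermitian_def
      proof (intro allI)
        fix i j
        have "W \<omega> $ j $ i = cnj (W \<omega> $ i $ j)"
          using W_hermitian[OF \<omega>] unfolding hermitian_def by blast
        then show "(\<sigma> *\<^sub>R W \<omega>) $ j $ i = cnj ((\<sigma> *\<^sub>R W \<omega>) $ i $ j)" by simp
      qed
      show "norm (\<sigma> *\<^sub>R W \<omega> *v x) \<le> 3 * \<sigma> * sqrt n * norm x" for x
      proof -
        have "\<sigma> * norm (W \<omega> *v x) \<le> \<sigma> * (3 * sqrt n * norm x)"
          using reg[OF \<omega>E] \<sigma> by (intro mult_left_mono) auto
        then show ?thesis using \<sigma> by (simp add: scaleR_matrix_vector mult_ac)
      qed
      show "cmod ((\<sigma> *\<^sub>R W \<omega> *v zstar) $ j) \<le> 3 * \<sigma> * sqrt (n * ln n)" for j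
      proof -
        have "\<sigma> * cmod ((W \<omega> *v zstar) $ j) \<le> \<sigma> * (3 * sqrt (n * ln n))"
          using reg[OF \<omega>E] \<sigma> by (intro mult_left_mono) auto
        then show ?thesis using \<sigma> by (simp add: scaleR_matrix_vector)
      qed
    qed (use n zs \<sigma> \<alpha> in auto)
    have C\<omega>: "C \<omega> = ps.C" using C[OF \<omega>] by (simp add: ps.C_def)
    have est: "eigenvector_estimator ps.C (z0 \<omega>)" using z0[OF \<omega>] by (simp add: C\<omega>)
    have z01: "cmod (z0 \<omega> $ j) = 1" for j
      using ps.eigenvector_estimator_close[OF est] by metis
    show "phase_dist 2 (gpm (C \<omega>) \<alpha> (z0 \<omega>) (k + 1)) zstar
        \<le> ((\<alpha> + 16) / (7 * \<alpha> + 8)) ^ (k + 1) * phase_dist 2 (z0 \<omega>) zstar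
          + 24 * \<alpha> / (3 * \<alpha> - 4) * \<sigma>"
      unfolding C\<omega> by (rule ps.gpm_dist_2_le[OF z01 ps.estimator_pot_le[OF est]])
    have "phase_dist \<infinity> (gpm (C \<omega>) \<alpha> (z0 \<omega>) (k + 1)) zstar \<le> ps.T"
      unfolding C\<omega> by (rule ps.gpm_dist_infty_le[OF est])
    moreover have "0 \<le> (16 / (7 * \<alpha> + 8)) ^ (k + 1) * phase_dist \<infinity> (z0 \<omega>) zstar"
      using \<alpha> by (intro mult_nonneg_nonneg phase_dist_nonneg) auto
    moreover have "0 \<le> ((\<alpha> + 16) / (7 * \<alpha> + 8)) ^ (k + 1) * (sqrt n / 2)"
      using \<alpha> True by (intro mult_nonneg_nonneg) auto
    ultimately show "phase_dist \<infinity> (gpm (C \<omega>) \<alpha> (z0 \<omega>) (k + 1)) zstar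
        \<le> (16 / (7 * \<alpha> + 8)) ^ (k + 1) * phase_dist \<infinity> (z0 \<omega>) zstar
          + ((\<alpha> + 16) / (7 * \<alpha> + 8)) ^ (k + 1) * (sqrt n / 2)
          + 48 * \<alpha> / (7 * \<alpha> + 8) * (sqrt (ln n) + 24 * \<alpha> / (3 * \<alpha> - 4) * \<sigma>)
            * (\<sigma> / sqrt n)"
      unfolding ps.T_def by linarith
  qed
qed

end
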